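(* Let $a,b,k,M$ be positive integers and let $\chi$ be a Dirichlet character modulo $M$ with $\chi(-1)=(-1)^k$. Let $f\in M_k(M,\chi)$ and put $N=\operatorname{lcm}(Mb,a)$. Then the function $$\vartheta_{k;(a,b)}(f)(z) := b\,(Df)(bz) - \frac{k}{12}\, a\, E_2(az)\, f(bz)$$ is a modular form in $M_{k+2}(N,\chi)$. Furthermore, if $a$ and $b$ are relatively prime, then the function $$\frac{6a}{b}\,(DE_2)(az) + \frac{6b}{a}\,(DE_2)(bz) - E_2(az)E_2(bz)$$ is a modular form in $M_4(ab)$.
   Context: For a positive integer $M$, a Dirichlet character $\chi$ with $\chi(-1)=(-1)^k$, $M_k(M,\chi)$ denotes the space of holomorphic modular forms of weight $k$ on $\Gamma_0(M)$ with character $\chi$ (for level $N$ a multiple of $M$, $\chi$ is viewed as a character modulo $N$); $M_k(M)$ denotes the case of trivial character. $D=\frac{1}{2\pi i}\frac{d}{dz}$, and $(Dg)(cz)$ means the function $Dg$ evaluated at $cz$. $E_2(z)=1-24\sum_{n\ge1}\sigma(n)q^n$, $q=e^{2\pi i z}$, where $\sigma(n)=\sum_{d\mid n}d$ (the weight 2 quasimodular Eisenstein series). *)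

theory Defs
  imports "HOL-Complex_Analysis.Complex_Analysis"
begin

definition dirichlet_character :: "nat \<Rightarrow> (int \<Rightarrow> complex) \<Rightarrow> bool" where
  "dirichlet_character M chi \<longleftrightarrow>
     (\<forall>m n. chi (m * n) = chi m * chi n) \<and>
     (\<forall>n. chi (n + int M) = chi n) \<and>
     (\<forall>n. chi n \<noteq> 0 \<longleftrightarrow> coprime n (int M))"

text \<open>The character modulo \<open>N\<close> induced by \<open>chi\<close>, for \<open>N\<close> a multiple of the modulus of \<open>chi\<close>.\<close>

definition induced_character :: "nat \<Rightarrow> (int \<Rightarrow> complex) \<Rightarrow> int \<Rightarrow> complex" where
  "induced_character N chi n = (if coprime n (int N) then chi n else 0)"

definition trivial_character :: "nat \<Rightarrow> int \<Rightarrow> complex" where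
  "trivial_character N n = (if coprime n (int N) then 1 else 0)"

definition upper_half_plane :: "complex set" where
  "upper_half_plane = {z. Im z > 0}"

text \<open>The quadruple \<open>(a, b, c, d)\<close> stands for the matrix with rows \<open>(a, b)\<close> and \<open>(c, d)\<close>.\<close>

definition SL2Z :: "(int \<times> int \<times> int \<times> int) set" where
  "SL2Z = {(a, b, c, d). a * d - b * c = 1}"

definition Gamma0 :: "nat \<Rightarrow> (int \<times> int \<times> int \<times> int) set" where
  "Gamma0 N = {(a, b, c, d). (a, b, c, d) \<in> SL2Z \<and> int N dvd c}"

definition slash ::
    "nat \<Rightarrow> (complex \<Rightarrow> complex) \<Rightarrow> int \<times> int \<times> int \<times> int \<Rightarrow> complex \<Rightarrow> complex" where
  "slash k f = (\<lambda>(a, b, c, d) z.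
     f ((of_int a * z + of_int b) / (of_int c * z + of_int d)) / (of_int c * z + of_int d) ^ k)"

text \<open>\<open>F\<close> is a holomorphic function of \<open>exp (2 * pi * \<i> * z / h)\<close> on the full unit disc,
  the centre of which corresponds to the cusp \<open>\<i>\<infinity>\<close>. The width \<open>h\<close> may depend on \<open>F\<close>.\<close>

definition holomorphic_at_infinity :: "(complex \<Rightarrow> complex) \<Rightarrow> bool" where
  "holomorphic_at_infinity F \<longleftrightarrow>
     (\<exists>h::nat. h > 0 \<and> (\<exists>g. g holomorphic_on ball 0 1 \<and>
        (\<forall>z\<in>upper_half_plane. F z = g (exp (2 * of_real pi * \<i> * z / of_nat h)))))"

text \<open>The space \<open>M_k(N, chi)\<close>. Its elements are total functions of which only the values on the
  upper half-plane matter. Holomorphy at the cusps is required at every cusp, as the condition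
  on \<open>slash k f \<gamma>\<close> ranges over all of \<open>SL2Z\<close>.\<close>

definition modular_forms :: "nat \<Rightarrow> nat \<Rightarrow> (int \<Rightarrow> complex) \<Rightarrow> (complex \<Rightarrow> complex) set" where
  "modular_forms k N chi = {f.
     f holomorphic_on upper_half_plane \<and>
     (\<forall>(a, b, c, d)\<in>Gamma0 N. \<forall>z\<in>upper_half_plane. slash k f (a, b, c, d) z = chi d * f z) \<and>
     (\<forall>\<gamma>\<in>SL2Z. holomorphic_at_infinity (slash k f \<gamma>))}"

definition divisor_sigma :: "nat \<Rightarrow> nat" where
  "divisor_sigma n = (\<Sum>d | d dvd n. d)"

definition E2 :: "complex \<Rightarrow> complex" where
  "E2 z = 1 - 24 * (\<Sum>n. of_nat (divisor_sigma (Suc n)) * exp (2 * of_real pi * \<i> * z) ^ Suc n)"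

definition D :: "(complex \<Rightarrow> complex) \<Rightarrow> complex \<Rightarrow> complex" where
  "D g z = 1 / (2 * of_real pi * \<i>) * deriv g z"

definition vartheta :: "nat \<Rightarrow> nat \<Rightarrow> nat \<Rightarrow> (complex \<Rightarrow> complex) \<Rightarrow> complex \<Rightarrow> complex" where
  "vartheta k a b f z =
     of_nat b * D f (of_nat b * z) - of_nat k / 12 * of_nat a * E2 (of_nat a * z) * f (of_nat b * z)"

end

theory Submission imports Defs begin

text \<open>
  Write \<open>X = c / (c z + d)\<close> for a matrix \<open>\<gamma>\<close> with lower row \<open>(c, d)\<close>. Differentiating
  \<open>g |\<^sub>k \<gamma> = K\<close> gives \<open>(D g) |\<^sub>k\<^sub>+\<^sub>2 \<gamma> = D K + k / (2 pi i) X K\<close>, and the transformation law of \<open>E2\<close> gives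
  \<open>E2 (a z) |\<^sub>2 \<gamma> = H + 6 / (pi i a) X\<close>. Both \<open>K\<close> (for \<open>g z = f (b z)\<close>) and \<open>H\<close> are found by moving the
  scaling matrix past \<open>\<gamma>\<close>: \<open>(n, 0; 0, 1) \<gamma> = \<gamma>' (A, B; 0, E)\<close>. In the combinations of the theorem the
  terms containing \<open>X\<close> cancel for every \<open>\<gamma>\<close> in \<open>SL2Z\<close>, leaving the same combination of \<open>K\<close>, \<open>H\<close> and
  their derivatives. This shows holomorphy at all cusps, and also the invariance, since for \<open>\<gamma>\<close> in
  \<open>Gamma0 N\<close> one can take \<open>B = 0\<close> and \<open>E = 1\<close>.

  The law \<open>E2 (- 1 / z) = z^2 E2 z + 6 z / (pi i)\<close> is Eisenstein's: \<open>E2 z\<close> and \<open>E2 (- 1 / z) / z^2\<close> are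
  the two iterated sums of the same conditionally convergent double series over \<open>1 / (m z + n)^2\<close>, and
  the difference is computed by subtracting a telescoping series.
\<close>

subsection \<open>Partial fractions of the cotangent\<close>

lemma upper_half_plane_iff [simp]: "z \<in> upper_half_plane \<longleftrightarrow> Im z > 0"
  by (simp add: upper_half_plane_def)

lemma open_upper_half_plane: "open upper_half_plane"
  by (simp add: upper_half_plane_def open_halfspace_Im_gt)

lemma not_Ints_complexD:
  fixes z :: complex
  assumes "z \<notin> \<int>"
  shows "z \<notin> \<int>\<^sub>\<le>\<^sub>0" "1 - z \<notin> \<int>\<^sub>\<le>\<^sub>0" "sin (of_real pi * z) \<noteq> 0"
proof -
  show "z \<notin> \<int>\<^sub>\<le>\<^sub>0" "1 - z \<notin> \<int>\<^sub>\<le>\<^sub>0"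
    using assms by (auto dest!: subsetD[OF nonpos_Ints_subset_Ints])
  show "sin (of_real pi * z) \<noteq> 0"
    using assms by (metis Ints_of_int mult_cancel_left of_real_eq_0_iff pi_neq_zero sin_eq_0
        mult.commute of_real_mult of_real_of_int_eq)
qed

text \<open>This is the logarithmic derivative of the reflection formula
  \<open>rGamma z * rGamma (1 - z) = sin (pi z) / pi\<close>. The reciprocal Gamma functions are
  entire, so the product can be differentiated in either form.\<close>

lemma Digamma_reflection_complex:
  fixes z :: complex
  assumes "z \<notin> \<int>"
  shows "Digamma (1 - z) - Digamma z = of_real pi * cot (of_real pi * z)"
proof -
  note z = not_Ints_complexD(1,2)[OF assms] and s = not_Ints_complexD(3)[OF assms]
  define h where "h = (\<lambda>z::complex. rGamma z * rGamma (1 - z))"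
  have "(h has_field_derivative
      (- rGamma z * Digamma z) * rGamma (1 - z) + rGamma z * (rGamma (1 - z) * Digamma (1 - z))) (at z)"
    unfolding h_def using z by (auto intro!: derivative_eq_intros)
  moreover have "((\<lambda>z. sin (of_real pi * z) / of_real pi) has_field_derivative cos (of_real pi * z)) (at z)"
    by (auto intro!: derivative_eq_intros)
  hence "(h has_field_derivative cos (of_real pi * z)) (at z)"
    unfolding h_def by (simp add: rGamma_reflection_complex)
  ultimately have "(- rGamma z * Digamma z) * rGamma (1 - z) + rGamma z * (rGamma (1 - z) * Digamma (1 - z))
      = cos (of_real pi * z)"
    by (rule DERIV_unique)
  hence "h z * (Digamma (1 - z) - Digamma z) = cos (of_real pi * z)"
    by (simp add: h_def algebra_simps)
  thus ?thesis
    using s by (simp add: h_def rGamma_reflection_complex cot_def field_simps)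
qed

text \<open>Obtained by differentiating the Digamma reflection formula. As
  \<open>Polygamma 1\<close> is a series of inverse squares over one half-line of integers, this is
  the expansion of \<open>pi^2 / sin^2\<close> over all integers.\<close>

lemma Polygamma_1_reflection_complex:
  fixes z :: complex
  assumes "z \<notin> \<int>"
  shows "Polygamma 1 z + Polygamma 1 (1 - z) = of_real pi ^ 2 / sin (of_real pi * z) ^ 2"
proof -
  note z = not_Ints_complexD(1,2)[OF assms] and s = not_Ints_complexD(3)[OF assms]
  have op: "open (- \<int> :: complex set)" by (auto intro: closed_Ints)
  have "((\<lambda>z. Digamma (1 - z) - Digamma z) has_field_derivative
      - Polygamma 1 (1 - z) - Polygamma 1 z) (at z)"
    using z by (auto intro!: derivative_eq_intros)
  moreover have "((\<lambda>z. of_real pi * cot (of_real pi * z)) has_field_derivative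
      - (of_real pi ^ 2 / sin (of_real pi * z) ^ 2)) (at z)"
    by (rule derivative_eq_intros DERIV_chain2[where f = cot and g = "\<lambda>z. of_real pi * z", OF DERIV_cot[OF s]] refl)+
      (simp add: power2_eq_square field_simps)
  hence "((\<lambda>z. Digamma (1 - z) - Digamma z) has_field_derivative
      - (of_real pi ^ 2 / sin (of_real pi * z) ^ 2)) (at z)"
    by (rule has_field_derivative_transform_within_open[OF _ op])
      (use assms in \<open>auto simp: Digamma_reflection_complex\<close>)
  ultimately have "- Polygamma 1 (1 - z) - Polygamma 1 z = - (of_real pi ^ 2 / sin (of_real pi * z) ^ 2)"
    by (rule DERIV_unique)
  thus ?thesis by (simp add: algebra_simps)
qed

text \<open>Subtracting the Digamma series at \<open>1 + w\<close> and \<open>1 - w\<close> cancels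
  the harmonic terms and the Euler-Mascheroni constant. The recurrence and the reflection formula
  evaluate what is left.\<close>

lemma cot_partial_fractions:
  fixes w :: complex
  assumes "w \<notin> \<int>"
  shows "(\<lambda>k. 2 * w / (of_nat (Suc k) ^ 2 - w ^ 2)) sums (1 / w - of_real pi * cot (of_real pi * w))"
proof -
  have nz: "of_nat n + w \<noteq> 0" "of_nat n - w \<noteq> 0" for n
    using assms by (metis Ints_minus Ints_of_nat add.commute add_eq_0_iff minus_minus)
      (metis Ints_of_nat assms eq_iff_diff_eq_0)
  have nz': "1 + w \<noteq> 0" "1 - w \<noteq> 0" "w \<noteq> 0"
    using nz[of 1] assms by auto
  have "(\<lambda>k. inverse (of_nat (Suc k)) - inverse (1 + w + of_nat k)) sums (Digamma (1 + w) + euler_mascheroni)"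
    "(\<lambda>k. inverse (of_nat (Suc k)) - inverse (1 - w + of_nat k)) sums (Digamma (1 - w) + euler_mascheroni)"
    using summable_Digamma[of "1 + w"] summable_Digamma[of "1 - w"] nz'
    by (simp_all add: Digamma_def summable_sums)
  from sums_diff[OF this]
  have "(\<lambda>k. inverse (1 - w + of_nat k) - inverse (1 + w + of_nat k)) sums (Digamma (1 + w) - Digamma (1 - w))"
    by simp
  moreover have "inverse (1 - w + of_nat k) - inverse (1 + w + of_nat k) = 2 * w / (of_nat (Suc k) ^ 2 - w ^ 2)" for k
  proof -
    have "of_nat (Suc k) - w \<noteq> 0" "of_nat (Suc k) + w \<noteq> 0" using nz by blast+
    moreover have "1 - w + of_nat k = of_nat (Suc k) - w" "1 + w + of_nat k = of_nat (Suc k) + w" by simp_all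
    moreover have "of_nat (Suc k) ^ 2 - w ^ 2 = (of_nat (Suc k) - w) * (of_nat (Suc k) + w)"
      by (simp only: power2_eq_square algebra_simps)
    ultimately show ?thesis
      by (simp only: ) (simp add: divide_simps del: of_nat_Suc)
  qed
  moreover have "Digamma (1 + w) - Digamma (1 - w) = 1 / w - of_real pi * cot (of_real pi * w)"
    using Digamma_plus1[of w] nz' Digamma_reflection_complex[OF assms] by (simp add: algebra_simps)
  ultimately show ?thesis by simp
qed

text \<open>Lipschitz's formula in weight 2. The series omits the integer 0, hence the term
  \<open>- 1 / z ^ 2\<close>; the quotient \<open>q / (1 - q) ^ 2\<close> is the sum of
  \<open>d * q ^ d\<close>.\<close>

lemma sum_inverse_squares_shifted:
  fixes z :: complex
  assumes "Im z > 0"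
  defines "q \<equiv> exp (2 * of_real pi * \<i> * z)"
  shows "(\<lambda>n. 1 / (z + of_nat (Suc n)) ^ 2 + 1 / (z - of_nat (Suc n)) ^ 2) sums
           (- 4 * of_real pi ^ 2 * (q / (1 - q) ^ 2) - 1 / z ^ 2)"
proof -
  have zi: "z \<notin> \<int>" using assms by (auto elim!: Ints_cases)
  have nz: "1 + z \<noteq> 0" "1 - z \<noteq> 0" "z \<noteq> 0" using assms by (auto simp: complex_eq_iff)
  have "(\<lambda>n. inverse ((1 + z + of_nat n) ^ 2)) sums Polygamma 1 (1 + z)"
    "(\<lambda>n. inverse ((1 - z + of_nat n) ^ 2)) sums Polygamma 1 (1 - z)"
    using Polygamma_LIMSEQ[of "1 + z" 1] Polygamma_LIMSEQ[of "1 - z" 1] nz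
    by (simp_all add: numeral_2_eq_2)
  from sums_add[OF this]
  have "(\<lambda>n. inverse ((1 + z + of_nat n) ^ 2) + inverse ((1 - z + of_nat n) ^ 2)) sums
      (Polygamma 1 (1 + z) + Polygamma 1 (1 - z))" .
  moreover have "Polygamma 1 (1 + z) + Polygamma 1 (1 - z) = of_real pi ^ 2 / sin (of_real pi * z) ^ 2 - 1 / z ^ 2"
    using Polygamma_plus1[OF nz(3), of 1] Polygamma_1_reflection_complex[OF zi]
    by (simp add: add.commute[of 1 z] power2_eq_square)
  moreover have "of_real pi ^ 2 / sin (of_real pi * z) ^ 2 = - 4 * of_real pi ^ 2 * (q / (1 - q) ^ 2)"
  proof -
    \<comment> \<open>A square root of \<open>q\<close>, in terms of which the sine is
      rational.\<close>
    define e where "e = exp (\<i> * (of_real pi * z))"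
    have q: "q = e ^ 2" by (simp add: q_def e_def exp_double[symmetric] mult_ac)
    have e: "e \<noteq> 0" by (simp add: e_def)
    have "norm q < 1" using assms by (simp add: q_def)
    hence "q \<noteq> 1" by auto
    hence q1: "1 - e ^ 2 \<noteq> 0" by (simp add: q)
    have "sin (of_real pi * z) = (e - 1 / e) / (2 * \<i>)"
      by (simp add: sin_exp_eq e_def exp_minus inverse_eq_divide)
    also have "\<dots> = - (1 - e ^ 2) / (2 * \<i> * e)" using e by (simp add: field_simps power2_eq_square)
    also have "\<dots> ^ 2 = - ((1 - q) ^ 2 / (4 * q))"
      by (simp add: power_divide power_mult_distrib q power2_commute[of 1 "e ^ 2"])
    finally have sq: "sin (of_real pi * z) ^ 2 = - ((1 - q) ^ 2 / (4 * q))" .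
    show ?thesis unfolding sq using e q1 by (simp add: q)
  qed
  moreover have "inverse ((1 + z + of_nat n) ^ 2) + inverse ((1 - z + of_nat n) ^ 2) =
      1 / (z + of_nat (Suc n)) ^ 2 + 1 / (z - of_nat (Suc n)) ^ 2" for n
  proof -
    have "(1 - z + of_nat n) ^ 2 = (z - of_nat (Suc n)) ^ 2" by (simp add: power2_eq_square algebra_simps)
    thus ?thesis by (simp add: inverse_eq_divide add_ac)
  qed
  ultimately show ?thesis by simp
qed

text \<open>The cotangent is a Moebius function of \<open>exp (- 2 * \<i> * w)\<close>, which tends
  to 0 in the lower half-plane. This limit is the source of the non-modular term of
  \<open>E2\<close>.\<close>

lemma tendsto_cot_lower:
  fixes w :: "nat \<Rightarrow> complex"
  assumes "filterlim (\<lambda>n. Im (w n)) at_bot sequentially"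
  shows "(\<lambda>n. cot (w n)) \<longlonglongrightarrow> \<i>"
proof -
  have "filterlim (\<lambda>n. 2 * Im (w n)) at_bot sequentially"
    by (intro filterlim_tendsto_pos_mult_at_bot[OF tendsto_const]) (use assms in auto)
  hence "(\<lambda>n. exp (2 * Im (w n))) \<longlonglongrightarrow> 0"
    by (rule filterlim_compose[OF exp_at_bot])
  hence "(\<lambda>n. norm (exp (- 2 * \<i> * w n))) \<longlonglongrightarrow> 0" by simp
  hence e: "(\<lambda>n. exp (- 2 * \<i> * w n)) \<longlonglongrightarrow> 0" by (rule tendsto_norm_zero_cancel)
  hence "(\<lambda>n. \<i> * (1 + exp (- 2 * \<i> * w n)) / (1 - exp (- 2 * \<i> * w n))) \<longlonglongrightarrow> \<i> * (1 + 0) / (1 - 0)"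
    by (intro tendsto_intros) auto
  moreover have "\<i> * (1 + exp (- 2 * \<i> * w)) / (1 - exp (- 2 * \<i> * w)) = cot w" for w :: complex
  proof -
    have "exp (- 2 * \<i> * w) = exp (- (\<i> * w)) ^ 2" by (simp add: exp_double[symmetric] mult.assoc)
    hence "exp (- 2 * \<i> * w) = (1 / exp (\<i> * w)) ^ 2" by (simp add: exp_minus inverse_eq_divide)
    hence *: "exp (- 2 * \<i> * w) = 1 / exp (\<i> * w) ^ 2" by (simp add: power_divide)
    show ?thesis
      unfolding cot_def sin_exp_eq cos_exp_eq * exp_minus
      by (simp add: divide_simps power2_eq_square) (auto simp: algebra_simps)
  qed
  ultimately show ?thesis by simp
qed

subsection \<open>Interchanging Eisenstein's double series\<close>

text \<open>Unordered summability permits Fubini in both directions; uniqueness of limits identifies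
  the ordered sums \<open>r m\<close> and \<open>c n\<close> with the unordered ones.\<close>

lemma double_series_swap:
  fixes e :: "nat \<Rightarrow> nat \<Rightarrow> complex"
  assumes summable: "(\<lambda>(m, n). e m n) summable_on UNIV"
    and rows: "\<And>m. (\<lambda>n. e m n) sums r m" and columns: "\<And>n. (\<lambda>m. e m n) sums c n"
  obtains S where "r sums S" and "c sums S"
proof -
  define S where "S = infsum (\<lambda>(m, n). e m n) UNIV"
  have S: "((\<lambda>(m, n). e m n) has_sum S) (UNIV \<times> UNIV)"
    using summable by (simp add: S_def)
  have "(\<lambda>n. e m n) summable_on UNIV" for m
    using summable_on_SigmaD1[of e UNIV "\<lambda>_. UNIV"] summable by simp
  hence "((\<lambda>n. e m n) has_sum r m) UNIV" for m
    using rows by (metis has_sum_imp_sums has_sum_infsum sums_unique2)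
  hence "(r has_sum S) UNIV"
    using has_sum_Sigma'[OF S] by simp
  have S': "((\<lambda>(n, m). e m n) has_sum S) (UNIV \<times> UNIV)"
    using has_sum_swap[THEN iffD1, OF S] by simp
  hence "(\<lambda>(n, m). e m n) summable_on UNIV \<times> UNIV"
    by (auto intro: has_sum_imp_summable)
  hence "(\<lambda>m. e m n) summable_on UNIV" for n
    using summable_on_SigmaD1[of "\<lambda>n m. e m n" UNIV "\<lambda>_. UNIV"] by simp
  hence "((\<lambda>m. e m n) has_sum c n) UNIV" for n
    using columns by (metis has_sum_imp_sums has_sum_infsum sums_unique2)
  hence "(c has_sum S) UNIV"
    using has_sum_Sigma'[OF S'] by simp
  show thesis
    using that \<open>(r has_sum S) UNIV\<close> \<open>(c has_sum S) UNIV\<close> by (blast intro: has_sum_imp_sums)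
qed

section \<open>Lambert series for the divisor sums\<close>

text \<open>The type is left general because the formula is used for complex powers of
  \<open>q\<close> and also for the real powers of \<open>norm q\<close> that dominate them.\<close>

lemma has_sum_linear_geometric:
  fixes t :: "'a :: {real_normed_field, banach}"
  assumes "norm t < 1"
  shows "((\<lambda>d. of_nat (Suc d) * t ^ Suc d) has_sum (t / (1 - t) ^ 2)) UNIV"
proof (rule norm_summable_imp_has_sum)
  have "(\<lambda>d. t * (of_nat (Suc d) * t ^ d)) sums (t * (1 / (1 - t) ^ 2))"
    by (intro sums_mult geometric_deriv_sums assms)
  thus "(\<lambda>d. of_nat (Suc d) * t ^ Suc d) sums (t / (1 - t) ^ 2)"
    by (simp add: mult_ac)
  have "(\<lambda>d. norm t * (of_nat (Suc d) * norm t ^ d)) sums (norm t * (1 / (1 - norm t) ^ 2))"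
    by (intro sums_mult geometric_deriv_sums) (use assms in auto)
  hence "summable (\<lambda>d. of_nat (Suc d) * norm t ^ Suc d)"
    by (auto simp: mult_ac sums_iff)
  thus "summable (\<lambda>d. norm (of_nat (Suc d) * t ^ Suc d))"
    by (simp add: norm_mult norm_power del: of_nat_Suc)
qed

text \<open>Both series are rearrangements of the double series of \<open>d * q ^ (m * d)\<close>
  over positive \<open>m\<close> and \<open>d\<close>: one sums over \<open>d\<close> first, the
  other collects the pairs with a given product.\<close>

lemma lambert_series_divisor_sigma:
  fixes q :: complex
  assumes q: "norm q < 1"
  obtains S where "(\<lambda>n. of_nat (divisor_sigma (Suc n)) * q ^ Suc n) sums S"
    and "(\<lambda>m. q ^ Suc m / (1 - q ^ Suc m) ^ 2) sums S"
proof -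
  define F :: "nat \<times> nat \<Rightarrow> complex" where "F = (\<lambda>(m, d). of_nat (Suc d) * q ^ (Suc m * Suc d))"
  have pow: "norm q ^ Suc m < 1" "norm q ^ Suc m \<le> norm q" for m
    using q power_decreasing[of 1 "Suc m" "norm q"] by (simp_all add: power_Suc_less_one del: power_Suc)
  \<comment> \<open>Summing the norms over \<open>d\<close> gives the same closed form at
    \<open>norm q\<close>; its denominators are at least \<open>(1 - norm q) ^ 2\<close>, so a
    geometric series dominates.\<close>
  have "(\<lambda>x. norm (F x)) summable_on UNIV \<times> UNIV"
  proof (rule summable_on_SigmaI)
    fix m
    have "norm (norm q ^ Suc m) < 1" using pow[of m] by simp
    from has_sum_linear_geometric[OF this]
    show "((\<lambda>d. norm (F (m, d))) has_sum (norm q ^ Suc m / (1 - norm q ^ Suc m) ^ 2)) UNIV"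
      by (simp add: F_def norm_mult norm_power power_mult del: of_nat_Suc power_Suc mult_Suc mult_Suc_right)
  next
    have "summable (\<lambda>m. norm q ^ Suc m / (1 - norm q) ^ 2)"
      using q by (intro summable_divide) (auto intro: summable_geometric summable_mult)
    hence "summable (\<lambda>m. norm q ^ Suc m / (1 - norm q ^ Suc m) ^ 2)"
    proof (rule summable_comparison_test[rotated], intro exI allI impI)
      fix m
      have "(1 - norm q) ^ 2 \<le> (1 - norm q ^ Suc m) ^ 2"
        using pow[of m] q by (intro power_mono) auto
      thus "norm (norm q ^ Suc m / (1 - norm q ^ Suc m) ^ 2) \<le> norm q ^ Suc m / (1 - norm q) ^ 2"
        using q by (auto simp del: power_Suc intro!: divide_left_mono mult_pos_pos)
    qed
    thus "(\<lambda>m. norm q ^ Suc m / (1 - norm q ^ Suc m) ^ 2) summable_on UNIV"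
      using q by (subst summable_on_UNIV_nonneg_real_iff) auto
  qed auto
  hence "F summable_on UNIV \<times> UNIV" by (rule abs_summable_summable)
  then obtain S where S: "(F has_sum S) (UNIV \<times> UNIV)" by (auto simp: summable_on_def)
  have "((\<lambda>m. q ^ Suc m / (1 - q ^ Suc m) ^ 2) has_sum S) UNIV"
  proof (rule has_sum_Sigma'[OF S])
    fix m
    have "norm (q ^ Suc m) < 1" using pow[of m] by (simp add: norm_power del: power_Suc)
    from has_sum_linear_geometric[OF this]
    show "((\<lambda>d. F (m, d)) has_sum (q ^ Suc m / (1 - q ^ Suc m) ^ 2)) UNIV"
      by (simp add: F_def power_mult del: of_nat_Suc power_Suc mult_Suc mult_Suc_right)
  qed
  \<comment> \<open>All indices of \<open>F\<close> are shifted by one, whereas in the new index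
    pair \<open>n\<close> is the product minus one and \<open>d\<close> is the divisor
    itself.\<close>
  moreover have "(F has_sum S) (UNIV \<times> UNIV) \<longleftrightarrow>
      ((\<lambda>(n, d). of_nat d * q ^ Suc n) has_sum S) (SIGMA n:UNIV. {d. d dvd Suc n})"
  proof (rule has_sum_reindex_bij_witness
      [where i = "\<lambda>(n, d). (Suc n div d - 1, d - 1)" and j = "\<lambda>(m, d). (Suc m * Suc d - 1, Suc d)"])
    fix x :: "nat \<times> nat"
    obtain m d where x: "x = (m, d)" by force
    have eq: "Suc (Suc m * Suc d - 1) = Suc m * Suc d" by simp
    have "Suc (Suc m * Suc d - 1) div Suc d - 1 = m" "Suc d dvd Suc (Suc m * Suc d - 1)"
      unfolding eq by (simp_all only: nonzero_mult_div_cancel_right dvd_triv_right)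
    thus "(\<lambda>(n, d). (Suc n div d - 1, d - 1)) ((\<lambda>(m, d). (Suc m * Suc d - 1, Suc d)) x) = x"
      "(\<lambda>(m, d). (Suc m * Suc d - 1, Suc d)) x \<in> (SIGMA n:UNIV. {d. d dvd Suc n})"
      "(\<lambda>(n, d). of_nat d * q ^ Suc n) ((\<lambda>(m, d). (Suc m * Suc d - 1, Suc d)) x) = F x"
      unfolding x F_def by (simp_all add: eq del: mult_Suc mult_Suc_right power_Suc of_nat_Suc)
  next
    fix x :: "nat \<times> nat"
    assume "x \<in> (SIGMA n:UNIV. {d. d dvd Suc n})"
    then obtain n d where x: "x = (n, d)" "d dvd Suc n" by auto
    then obtain e where e: "Suc n = d * e" by auto
    hence "d > 0" "e > 0" by (auto intro: Nat.gr0I)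
    thus "(\<lambda>(m, d). (Suc m * Suc d - 1, Suc d)) ((\<lambda>(n, d). (Suc n div d - 1, d - 1)) x) = x"
      using e by (simp add: x del: mult_Suc mult_Suc_right) (simp add: mult.commute flip: e)
  qed auto
  with S have "((\<lambda>(n, d). of_nat d * q ^ Suc n) has_sum S) (SIGMA n:UNIV. {d. d dvd Suc n})"
    by blast
  hence "((\<lambda>n. of_nat (divisor_sigma (Suc n)) * q ^ Suc n) has_sum S) UNIV"
    by (rule has_sum_Sigma')
      (auto simp: divisor_sigma_def sum_distrib_right simp del: power_Suc intro!: has_sum_finiteI)
  ultimately show thesis
    using that by (blast intro: has_sum_imp_sums)
qed

section \<open>Absolute convergence of lattice sums of cubic decay\<close>

text \<open>The majorant for the double series: as a product of two convergent one-variable series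
  it needs no counting of lattice points.\<close>

lemma summable_on_powr_product:
  "(\<lambda>(m, n). real (Suc m) powr (-3/2) * real (Suc n) powr (-3/2)) summable_on UNIV"
proof -
  have "summable (\<lambda>n. real (Suc n) powr (-3/2))"
    by (subst summable_Suc_iff) (simp add: summable_real_powr_iff)
  hence "(\<lambda>n. real (Suc n) powr (-3/2)) summable_on UNIV"
    by (subst summable_on_UNIV_nonneg_real_iff) auto
  then obtain G where G: "((\<lambda>n. real (Suc n) powr (-3/2)) has_sum G) UNIV"
    by (auto simp: summable_on_def)
  have "(\<lambda>(m, n). real (Suc m) powr (-3/2) * real (Suc n) powr (-3/2)) summable_on (UNIV \<times> UNIV)"
  proof (rule summable_on_SigmaI)
    show "((\<lambda>n. case (m, n) of (m, n) \<Rightarrow> real (Suc m) powr (-3/2) * real (Suc n) powr (-3/2)) has_sum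
        real (Suc m) powr (-3/2) * G) UNIV" for m
      using has_sum_cmult_right[OF G] by simp
    show "(\<lambda>m. real (Suc m) powr (-3/2) * G) summable_on UNIV"
      using has_sum_cmult_left[OF G] by (auto simp: summable_on_def)
  qed auto
  thus ?thesis by simp
qed

text \<open>From \<open>x * y \<le> (x + y) ^ 2\<close>, raised to the power 3/2. Cubic decay
  thereby splits into two exponents, each still beyond 1.\<close>

lemma inverse_cube_le_powr_product:
  fixes x y :: real
  assumes "x > 0" "y > 0"
  shows "1 / (x + y) ^ 3 \<le> x powr (-3/2) * y powr (-3/2)"
proof -
  have "(x * y) powr (3/2) \<le> ((x + y) ^ 2) powr (3/2)"
    using assms by (intro powr_mono2) (auto simp: power2_eq_square algebra_simps)
  also have "\<dots> = (x + y) ^ 3"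
    using assms by (simp add: powr_powr flip: powr_numeral)
  finally have "1 / (x + y) ^ 3 \<le> 1 / (x * y) powr (3/2)"
    using assms by (intro divide_left_mono mult_pos_pos) auto
  also have "\<dots> = x powr (-3/2) * y powr (-3/2)"
    using assms by (simp add: powr_mult powr_minus divide_simps)
  finally show ?thesis .
qed

text \<open>The imaginary part of \<open>m z + t\<close> controls \<open>m\<close>, and then the
  triangle inequality controls \<open>t\<close>.\<close>

lemma norm_lattice_point_ge:
  fixes z :: complex
  assumes "Im z > 0"
  obtains c where "c > 0" and "\<And>m t :: real. m > 0 \<Longrightarrow> norm (of_real m * z + of_real t) \<ge> c * (m + \<bar>t\<bar>)"
proof
  define C where "C = 1 / Im z + (1 + norm z / Im z)"
  have C: "C > 0" unfolding C_def using assms by (intro add_pos_nonneg) auto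
  show "1 / C > 0" using C by simp
  fix m t :: real assume m: "m > 0"
  let ?N = "norm (of_real m * z + of_real t)"
  have "m * Im z \<le> ?N" using abs_Im_le_cmod[of "of_real m * z + of_real t"] m assms by simp
  hence m': "m \<le> ?N / Im z" using assms by (simp add: field_simps)
  have "\<bar>t\<bar> = norm ((of_real m * z + of_real t) - of_real m * z)" by simp
  also have "\<dots> \<le> ?N + norm (of_real m * z)" by (rule norm_triangle_ineq4)
  also have "norm (of_real m * z) = m * norm z" using m by (simp add: norm_mult)
  also have "m * norm z \<le> ?N / Im z * norm z" using m' by (intro mult_right_mono) auto
  finally have "m + \<bar>t\<bar> \<le> C * ?N" using m' by (simp add: C_def algebra_simps)
  thus "?N \<ge> 1 / C * (m + \<bar>t\<bar>)" using C by (simp add: field_simps)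
qed

section \<open>Eisenstein's series for \<open>E2\<close> and its two orders of summation\<close>

text \<open>The terms of Eisenstein's series at the lattice points with coefficients
  \<open>m + 1\<close> and plus or minus \<open>n + 1\<close>. Both axes are left out, and the
  negative multiples of \<open>z\<close> would only repeat these values.\<close>

definition lattice_pair :: "complex \<Rightarrow> nat \<Rightarrow> nat \<Rightarrow> complex" where
  "lattice_pair z m n = 1 / (of_nat (Suc m) * z + of_nat (Suc n)) ^ 2 +
     1 / (of_nat (Suc m) * z - of_nat (Suc n)) ^ 2"

lemma summable_divisor_sigma:
  assumes "norm q < 1"
  shows "summable (\<lambda>n. of_nat (divisor_sigma (Suc n)) * (q :: complex) ^ Suc n)"
  using lambert_series_divisor_sigma[OF assms] by (metis sums_summable)

text \<open>Lipschitz's formula evaluates each row and the Lambert series adds up the rows. The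
  subtracted \<open>1\<close> and \<open>1 / z ^ 2\<close> are the contributions of the two omitted
  axes, each a multiple of the sum of inverse squares.\<close>

lemma E2_lattice_sum:
  assumes z: "Im z > 0"
  obtains A where "\<And>m. lattice_pair z m sums A m"
    and "A sums (of_real pi ^ 2 / 6 * (E2 z - 1 - 1 / z ^ 2))"
proof -
  define q where "q = exp (2 * of_real pi * \<i> * z)"
  have q: "norm q < 1" using z by (simp add: q_def)
  obtain S where S: "(\<lambda>n. of_nat (divisor_sigma (Suc n)) * q ^ Suc n) sums S"
    "(\<lambda>m. q ^ Suc m / (1 - q ^ Suc m) ^ 2) sums S"
    using lambert_series_divisor_sigma[OF q] by blast
  have E2: "E2 z = 1 - 24 * S"
    using S(1) by (simp add: E2_def q_def sums_iff del: power_Suc)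
  define A where "A = (\<lambda>m. - 4 * of_real pi ^ 2 * (q ^ Suc m / (1 - q ^ Suc m) ^ 2)
      - 1 / (of_nat (Suc m) * z) ^ 2)"
  show thesis
  proof
    fix m
    have "Im (of_nat (Suc m) * z) > 0" using z by (simp del: of_nat_Suc)
    moreover have "exp (2 * of_real pi * \<i> * (of_nat (Suc m) * z)) = q ^ Suc m"
      unfolding q_def exp_of_nat_mult[symmetric] by (simp only: mult_ac)
    ultimately show "lattice_pair z m sums A m"
      using sum_inverse_squares_shifted[of "of_nat (Suc m) * z"]
      by (simp only: A_def lattice_pair_def[abs_def])
  next
    have "(\<lambda>m. complex_of_real (1 / (real m + 1) ^ 2)) sums of_real (pi ^ 2 / 6)"
      using sums_of_real[OF inverse_squares_sums, where ?'a = complex] by (simp add: add.commute)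
    hence "(\<lambda>m. 1 / z ^ 2 * complex_of_real (1 / (real m + 1) ^ 2)) sums (1 / z ^ 2 * of_real (pi ^ 2 / 6))"
      by (rule sums_mult)
    moreover have "1 / z ^ 2 * complex_of_real (1 / (real m + 1) ^ 2) = 1 / (of_nat (Suc m) * z) ^ 2" for m
      by (simp add: power_mult_distrib add_ac)
    ultimately have "(\<lambda>m. 1 / (of_nat (Suc m) * z) ^ 2) sums (1 / z ^ 2 * of_real (pi ^ 2 / 6))"
      by (simp only:)
    from sums_diff[OF sums_mult[OF S(2), of "- 4 * of_real pi ^ 2"] this]
    show "A sums (of_real pi ^ 2 / 6 * (E2 z - 1 - 1 / z ^ 2))"
      by (simp add: A_def[abs_def] E2 algebra_simps del: power_Suc of_nat_Suc)
  qed
qed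

text \<open>The telescoping terms \<open>column_tail z m (Suc n) - column_tail z m n\<close> approximate
  \<open>lattice_pair z m n\<close> so well that the difference is absolutely summable; hence they alone account
  for the dependence of Eisenstein's double series on the order of summation.\<close>

definition column_tail :: "complex \<Rightarrow> nat \<Rightarrow> nat \<Rightarrow> complex" where
  "column_tail z m n = 1 / (of_nat (Suc m) * z - of_nat n) - 1 / (of_nat (Suc m) * z + of_nat n)"

lemma lattice_point_nonzero:
  assumes "Im z > 0"
  shows "of_nat (Suc m) * z + of_nat n \<noteq> 0" "of_nat (Suc m) * z - of_nat n \<noteq> 0"
  using assms by (auto simp: complex_eq_iff simp del: of_nat_Suc)

text \<open>The sum telescopes, and \<open>column_tail z m n\<close> vanishes at
  \<open>n = 0\<close> and in the limit. Subtracting these terms therefore leaves the row sums of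
  \<open>lattice_pair\<close> unchanged.\<close>

lemma column_tail_row_sums:
  assumes z: "Im z > 0"
  shows "(\<lambda>n. column_tail z m (Suc n) - column_tail z m n) sums 0"
proof -
  have "(\<lambda>n. 1 / (w + complex_of_nat n)) \<longlonglongrightarrow> 0" for w
    by (intro tendsto_divide_0[OF tendsto_const] tendsto_add_filterlim_at_infinity[OF tendsto_const] tendsto_of_nat)
  from tendsto_diff[OF tendsto_minus[OF this] this, of "- (of_nat (Suc m) * z)" "of_nat (Suc m) * z"]
  moreover have "- (1 / (- (of_nat (Suc m) * z) + of_nat n)) - 1 / (of_nat (Suc m) * z + of_nat n) =
      column_tail z m n" for n
    by (simp only: column_tail_def minus_divide_right minus_add_distrib minus_minus add_uminus_conv_diff)
  ultimately have "(\<lambda>n. column_tail z m n) \<longlonglongrightarrow> 0" by simp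
  from telescope_sums[OF this] show ?thesis by (simp add: column_tail_def)
qed

text \<open>A column is the cotangent expansion at \<open>w = n / z\<close>, divided by
  \<open>z\<close>. As \<open>n\<close> grows, the imaginary part of \<open>n / z\<close> tends to
  minus infinity and the cotangent to \<open>\<i>\<close>, so unlike the rows the columns keep a
  nonzero limit.\<close>

lemma column_tail_column_sums:
  assumes z: "Im z > 0"
  obtains V where "\<And>n. (\<lambda>m. column_tail z m n) sums V n"
    and "V 0 = 0" and "V \<longlonglongrightarrow> - of_real pi * \<i> / z"
proof -
  \<comment> \<open>At \<open>n = 0\<close> the column is identically zero, while the cotangent
    expression has no meaning there.\<close>
  define V where "V = (\<lambda>n. if n = 0 then 0 else
    1 / z * (1 / (of_nat n / z) - of_real pi * cot (of_real pi * (of_nat n / z))))"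
  have z0: "z \<noteq> 0" using z by auto
  have Im: "Im (of_nat n / z) = - (of_nat n * (Im z / norm z ^ 2))" for n
    by (simp add: Im_divide cmod_power2)
  have pos: "Im z / norm z ^ 2 > 0" using z z0 by simp
  show thesis
  proof
    fix n
    show "(\<lambda>m. column_tail z m n) sums V n"
    proof (cases "n = 0")
      case False
      have "Im (of_nat n / z) \<noteq> 0" unfolding Im using z z0 False by simp
      hence "of_nat n / z \<notin> \<int>" by (auto elim!: Ints_cases)
      from sums_mult[OF cot_partial_fractions[OF this], of "1 / z"]
      have "(\<lambda>k. 1 / z * (2 * (of_nat n / z) / (of_nat (Suc k) ^ 2 - (of_nat n / z) ^ 2))) sums V n"
        using False by (simp add: V_def)
      moreover have "1 / z * (2 * (of_nat n / z) / (of_nat (Suc k) ^ 2 - (of_nat n / z) ^ 2)) =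
          column_tail z k n" for k
      proof -
        define x where "x = complex_of_nat (Suc k)"
        define y where "y = complex_of_nat n"
        have nz: "x * z + y \<noteq> 0" "x * z - y \<noteq> 0"
          using lattice_point_nonzero[OF z] unfolding x_def y_def by blast+
        have "x ^ 2 - (y / z) ^ 2 = (x * z + y) * (x * z - y) / z ^ 2"
          using z0 by (simp add: field_simps power2_eq_square)
        hence "1 / z * (2 * (y / z) / (x ^ 2 - (y / z) ^ 2)) = 2 * y / ((x * z + y) * (x * z - y))"
          using z0 nz by (simp add: field_simps power2_eq_square)
        also have "\<dots> = 1 / (x * z - y) - 1 / (x * z + y)"
          using nz by (simp add: divide_simps)
        finally show ?thesis by (simp only: x_def y_def column_tail_def)
      qed
      ultimately show ?thesis by simp
    qed (simp add: V_def column_tail_def)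
  next
    have "filterlim (\<lambda>n. real n * (pi * (Im z / norm z ^ 2))) at_top sequentially"
      by (intro filterlim_at_top_mult_tendsto_pos[OF tendsto_const] filterlim_real_sequentially
          mult_pos_pos pi_gt_zero pos)
    moreover have "Im (of_real pi * (of_nat n / z)) = - (real n * (pi * (Im z / norm z ^ 2)))" for n
      unfolding times_complex.sel Im by simp
    ultimately have "filterlim (\<lambda>n. Im (of_real pi * (of_nat n / z))) at_bot sequentially"
      by (simp only: filterlim_uminus_at_bot minus_minus)
    hence "(\<lambda>n. cot (of_real pi * (of_nat n / z))) \<longlonglongrightarrow> \<i>" by (rule tendsto_cot_lower)
    moreover have "(\<lambda>n. z / of_nat n) \<longlonglongrightarrow> 0"
      by (intro tendsto_divide_0[OF tendsto_const] tendsto_of_nat)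
    ultimately have "(\<lambda>n. 1 / z * (z / of_nat n - of_real pi * cot (of_real pi * (of_nat n / z))))
        \<longlonglongrightarrow> 1 / z * (0 - of_real pi * \<i>)"
      by (intro tendsto_intros)
    moreover have "eventually (\<lambda>n. 1 / z * (z / of_nat n - of_real pi * cot (of_real pi * (of_nat n / z))) = V n) sequentially"
      using eventually_gt_at_top[of 0] by eventually_elim (simp add: V_def)
    ultimately have "V \<longlonglongrightarrow> 1 / z * (0 - of_real pi * \<i>)"
      by (rule Lim_transform_eventually)
    thus "V \<longlonglongrightarrow> - of_real pi * \<i> / z" by simp
  qed (simp add: V_def)
qed

text \<open>For either sign of \<open>n\<close> the difference is, up to sign,
  \<open>1 / (Y ^ 2 * Y')\<close> with neighbouring lattice points \<open>Y\<close> and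
  \<open>Y'\<close>. It thus decays cubically, where \<open>lattice_pair\<close> by itself decays
  only quadratically.\<close>

lemma lattice_pair_minus_telescope_summable:
  assumes z: "Im z > 0"
  shows "(\<lambda>(m, n). lattice_pair z m n - (column_tail z m (Suc n) - column_tail z m n)) summable_on UNIV"
proof -
  obtain c where c: "c > 0" "\<And>m t :: real. m > 0 \<Longrightarrow> norm (of_real m * z + of_real t) \<ge> c * (m + \<bar>t\<bar>)"
    using norm_lattice_point_ge[OF z] by blast
  let ?g = "\<lambda>m n. 4 / c ^ 3 * (real (Suc m) powr (-3/2) * real (Suc n) powr (-3/2))"
  have "(\<lambda>x. norm (case x of (m, n) \<Rightarrow> lattice_pair z m n - (column_tail z m (Suc n) - column_tail z m n)))
      summable_on UNIV"
  proof (rule Infinite_Sum.abs_summable_on_comparison_test')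
    show "(\<lambda>(m, n). ?g m n) summable_on UNIV"
      using summable_on_cmult_right[OF summable_on_powr_product, of "4 / c ^ 3"]
      by (simp only: case_prod_unfold)
  next
    fix x :: "nat \<times> nat"
    obtain m n where x: "x = (m, n)" by force
    define M where "M = real (Suc m)"
    define N where "N = real (Suc n)"
    have MN: "M \<ge> 1" "N \<ge> 1" by (simp_all add: M_def N_def)
    have cube: "norm (1 / ((of_real M * z + of_real t) ^ 2 * (of_real M * z + of_real t'))) \<le>
        2 / c ^ 3 * (M powr (-3/2) * N powr (-3/2))"
      if "\<bar>t\<bar> = N" "\<bar>t'\<bar> = N - 1" for t t' :: real
    proof -
      have 1: "c * (M + N) \<le> norm (of_real M * z + of_real t)"
        using c(2)[of M t] MN that by simp
      \<comment> \<open>The neighbouring point has \<open>N - 1\<close>, possibly 0, in place of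
        \<open>N\<close>. Since \<open>M + N\<close> is at least 2, this costs no more than a factor
        2.\<close>
      have "c * (M + N) \<le> 2 * (c * (M + \<bar>t'\<bar>))"
        using c(1) MN that by simp
      also have "c * (M + \<bar>t'\<bar>) \<le> norm (of_real M * z + of_real t')"
        using c(2)[of M t'] MN by simp
      finally have 2: "c * (M + N) / 2 \<le> norm (of_real M * z + of_real t')" by simp
      have pos: "0 < c * (M + N)" using c MN by simp
      have pos3: "0 < c ^ 3 * (M + N) ^ 3 / 2" using c MN by simp
      have "c ^ 3 * (M + N) ^ 3 / 2 = (c * (M + N)) ^ 2 * (c * (M + N) / 2)"
        by (simp add: power2_eq_square power3_eq_cube)
      also have "\<dots> \<le> norm (of_real M * z + of_real t) ^ 2 * norm (of_real M * z + of_real t')"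
        using 1 2 pos by (intro mult_mono power_mono) auto
      finally have "1 / (norm (of_real M * z + of_real t) ^ 2 * norm (of_real M * z + of_real t')) \<le>
          1 / (c ^ 3 * (M + N) ^ 3 / 2)"
        using 1 2 pos pos3 by (intro divide_left_mono mult_pos_pos[of _ "c ^ 3 * (M + N) ^ 3 / 2"]
            mult_pos_pos[of "_ ^ 2"] zero_less_power) linarith+
      also have "\<dots> = 2 / c ^ 3 * (1 / (M + N) ^ 3)" by simp
      also have "\<dots> \<le> 2 / c ^ 3 * (M powr (-3/2) * N powr (-3/2))"
        using c(1) MN by (intro mult_left_mono inverse_cube_le_powr_product) auto
      finally show ?thesis by (simp add: norm_divide norm_mult norm_power)
    qed
    define X where "X = of_real M * z"
    have nz: "X + of_real N \<noteq> 0" "X - of_real N \<noteq> 0" "X + of_real (N - 1) \<noteq> 0" "X - of_real (N - 1) \<noteq> 0"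
      using lattice_point_nonzero[OF z, of m "Suc n"] lattice_point_nonzero[OF z, of m n]
      by (simp_all add: X_def M_def N_def)
    have "lattice_pair z m n - (column_tail z m (Suc n) - column_tail z m n) =
        (1 / (X + of_real N) ^ 2 + 1 / (X + of_real N) - 1 / (X + of_real (N - 1))) +
        (1 / (X - of_real N) ^ 2 - 1 / (X - of_real N) + 1 / (X - of_real (N - 1)))"
      by (simp add: lattice_pair_def column_tail_def X_def M_def N_def algebra_simps)
    also have "1 / (X + of_real N) ^ 2 + 1 / (X + of_real N) - 1 / (X + of_real (N - 1)) =
        - (1 / ((X + of_real N) ^ 2 * (X + of_real (N - 1))))"
      using nz by (simp add: divide_simps) (simp add: power2_eq_square algebra_simps)
    also have "1 / (X - of_real N) ^ 2 - 1 / (X - of_real N) + 1 / (X - of_real (N - 1)) =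
        1 / ((X - of_real N) ^ 2 * (X - of_real (N - 1)))"
      using nz by (simp add: divide_simps) (simp add: power2_eq_square algebra_simps)
    also have "norm (- (1 / ((X + of_real N) ^ 2 * (X + of_real (N - 1)))) +
        1 / ((X - of_real N) ^ 2 * (X - of_real (N - 1)))) \<le>
        2 / c ^ 3 * (M powr (-3/2) * N powr (-3/2)) + 2 / c ^ 3 * (M powr (-3/2) * N powr (-3/2))"
      using cube[of N "N - 1"] cube[of "- N" "- (N - 1)"] MN
      by (intro norm_triangle_mono) (simp_all add: X_def add_diff_eq diff_diff_eq2)
    also have "\<dots> = ?g m n" by (simp add: M_def N_def)
    finally show "norm (case x of (m, n) \<Rightarrow> lattice_pair z m n - (column_tail z m (Suc n) - column_tail z m n)) \<le>
        (case x of (m, n) \<Rightarrow> ?g m n)"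
      by (simp add: x)
  qed
  thus ?thesis by (rule abs_summable_summable)
qed

lemma E2_minus_inverse:
  assumes z: "Im z > 0"
  shows "E2 (- 1 / z) = z ^ 2 * E2 z + 6 / (of_real pi * \<i>) * z"
proof -
  have z0: "z \<noteq> 0" using z by auto
  have z': "Im (- 1 / z) > 0" using z z0 by (simp add: Im_divide cmod_power2 sum_power2_gt_zero_iff)
  obtain A where A: "\<And>m. lattice_pair z m sums A m" "A sums (of_real pi ^ 2 / 6 * (E2 z - 1 - 1 / z ^ 2))"
    using E2_lattice_sum[OF z] by blast
  obtain B where B: "\<And>n. lattice_pair (- 1 / z) n sums B n"
    "B sums (of_real pi ^ 2 / 6 * (E2 (- 1 / z) - 1 - 1 / (- 1 / z) ^ 2))"
    using E2_lattice_sum[OF z'] by blast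
  obtain V where V: "\<And>n. (\<lambda>m. column_tail z m n) sums V n" "V 0 = 0" "V \<longlonglongrightarrow> - of_real pi * \<i> / z"
    using column_tail_column_sums[OF z] by blast
  \<comment> \<open>The substitution \<open>z \<mapsto> - 1 / z\<close> exchanges the two lattice
    coordinates, so the columns for \<open>z\<close> are the rows for
    \<open>- 1 / z\<close>.\<close>
  have flip: "lattice_pair (- 1 / z) n m / z ^ 2 = lattice_pair z m n" for m n
  proof -
    define x where "x = complex_of_nat (Suc m)"
    define y where "y = complex_of_nat (Suc n)"
    have "(y * (- 1 / z) + x) ^ 2 = (x * z - y) ^ 2 / z ^ 2" "(y * (- 1 / z) - x) ^ 2 = (x * z + y) ^ 2 / z ^ 2"
      using z0 by (simp_all add: field_simps power2_eq_square)
    hence "(1 / (y * (- 1 / z) + x) ^ 2 + 1 / (y * (- 1 / z) - x) ^ 2) / z ^ 2 =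
        1 / (x * z + y) ^ 2 + 1 / (x * z - y) ^ 2"
      using z0 by (simp only:) (simp add: add_divide_distrib add.commute)
    thus ?thesis by (simp only: lattice_pair_def x_def y_def)
  qed
  have columns: "(\<lambda>m. lattice_pair z m n) sums (B n / z ^ 2)" for n
    using sums_divide[OF B(1)[of n], of "z ^ 2"] unfolding flip .
  have rows_e: "(\<lambda>n. lattice_pair z m n - (column_tail z m (Suc n) - column_tail z m n)) sums A m" for m
    using sums_diff[OF A(1) column_tail_row_sums[OF z]] by simp
  have columns_e: "(\<lambda>m. lattice_pair z m n - (column_tail z m (Suc n) - column_tail z m n)) sums
      (B n / z ^ 2 - (V (Suc n) - V n))" for n
    by (intro sums_diff columns V)
  obtain S where S: "A sums S" "(\<lambda>n. B n / z ^ 2 - (V (Suc n) - V n)) sums S"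
    using double_series_swap[OF lattice_pair_minus_telescope_summable[OF z] rows_e columns_e] by blast
  \<comment> \<open>The total of the telescoping corrections to the columns. The rows receive none,
    so this is the whole discrepancy between the two orders of summation.\<close>
  have "(\<lambda>n. V (Suc n) - V n) sums (- of_real pi * \<i> / z)"
    using telescope_sums[OF V(3)] V(2) by simp
  from sums_add[OF S(2) this] have "(\<lambda>n. B n / z ^ 2) sums (S - of_real pi * \<i> / z)" by simp
  with sums_divide[OF B(2), of "z ^ 2"]
  have "of_real pi ^ 2 / 6 * (E2 (- 1 / z) - 1 - 1 / (- 1 / z) ^ 2) / z ^ 2 = S - of_real pi * \<i> / z"
    by (rule sums_unique2)
  also have "S = of_real pi ^ 2 / 6 * (E2 z - 1 - 1 / z ^ 2)"
    using S(1) A(2) by (rule sums_unique2)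
  finally have "z ^ 2 * (of_real pi ^ 2 / 6 * (E2 (- 1 / z) - 1 - 1 / (- 1 / z) ^ 2) / z ^ 2) =
      z ^ 2 * (of_real pi ^ 2 / 6 * (E2 z - 1 - 1 / z ^ 2) - of_real pi * \<i> / z)"
    by (rule arg_cong)
  also have "z ^ 2 * (of_real pi ^ 2 / 6 * (E2 z - 1 - 1 / z ^ 2) - of_real pi * \<i> / z) =
      of_real pi ^ 2 / 6 * (z ^ 2 * E2 z - z ^ 2 - 1) - of_real pi * \<i> * z"
    using z0 by (simp add: algebra_simps) (simp add: power2_eq_square)
  also have "z ^ 2 * (of_real pi ^ 2 / 6 * (E2 (- 1 / z) - 1 - 1 / (- 1 / z) ^ 2) / z ^ 2) =
      of_real pi ^ 2 / 6 * (E2 (- 1 / z) - 1 - z ^ 2)"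
    using z0 by (simp add: power_divide)
  finally have eq: "of_real pi ^ 2 / 6 * (E2 (- 1 / z) - 1 - z ^ 2) =
      of_real pi ^ 2 / 6 * (z ^ 2 * E2 z - z ^ 2 - 1) - of_real pi * \<i> * z" .
  have "of_real pi ^ 2 * (E2 (- 1 / z) - z ^ 2 * E2 z) =
      6 * (of_real pi ^ 2 / 6 * (E2 (- 1 / z) - 1 - z ^ 2) - of_real pi ^ 2 / 6 * (z ^ 2 * E2 z - z ^ 2 - 1))"
    by (simp add: algebra_simps)
  also have "\<dots> = - 6 * of_real pi * \<i> * z"
    unfolding eq by (simp add: algebra_simps)
  finally have "of_real pi ^ 2 * (E2 (- 1 / z) - z ^ 2 * E2 z) = - 6 * of_real pi * \<i> * z" .
  hence "of_real pi * (of_real pi * (E2 (- 1 / z) - z ^ 2 * E2 z)) = of_real pi * (- 6 * \<i> * z)"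
    by (simp add: power2_eq_square mult_ac)
  hence "of_real pi * (E2 (- 1 / z) - z ^ 2 * E2 z) = - 6 * \<i> * z"
    by (subst (asm) mult_left_cancel) auto
  hence "E2 (- 1 / z) - z ^ 2 * E2 z = - 6 * \<i> * z / of_real pi"
    by (simp add: field_simps)
  also have "\<dots> = 6 / (of_real pi * \<i>) * z" by (simp add: field_simps)
  finally show ?thesis by (simp add: algebra_simps)
qed

subsection \<open>Functions holomorphic at infinity\<close>

text \<open>Holomorphy at infinity with the width held fixed, so that two functions can first be
  brought to a common width and then combined.\<close>

definition q_holomorphic :: "real \<Rightarrow> (complex \<Rightarrow> complex) \<Rightarrow> bool" where
  "q_holomorphic h F \<longleftrightarrow> (\<exists>g. g holomorphic_on ball 0 1 \<and>
        (\<forall>z\<in>upper_half_plane. F z = g (exp (2 * of_real pi * \<i> * z / of_real h))))"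

lemma holomorphic_at_infinity_iff:
  "holomorphic_at_infinity F \<longleftrightarrow> (\<exists>h::nat. h > 0 \<and> q_holomorphic (real h) F)"
  by (simp add: holomorphic_at_infinity_def q_holomorphic_def)

lemma norm_exp_upper_half_plane:
  "h > 0 \<Longrightarrow> Im z > 0 \<Longrightarrow> norm (exp (2 * of_real pi * \<i> * z / of_real h)) < 1"
  by (simp add: Re_divide_of_real)

lemma holomorphic_at_infinity_cong:
  "(\<And>z. Im z > 0 \<Longrightarrow> F z = G z) \<Longrightarrow> holomorphic_at_infinity F \<longleftrightarrow> holomorphic_at_infinity G"
  by (simp add: holomorphic_at_infinity_def)

lemma q_holomorphic_binop:
  assumes "q_holomorphic h F" "q_holomorphic h G"
  shows "q_holomorphic h (\<lambda>z. F z + G z)" "q_holomorphic h (\<lambda>z. F z * G z)"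
proof -
  obtain f g where "f holomorphic_on ball 0 1" "g holomorphic_on ball 0 1"
    "\<forall>z\<in>upper_half_plane. F z = f (exp (2 * of_real pi * \<i> * z / of_real h))"
    "\<forall>z\<in>upper_half_plane. G z = g (exp (2 * of_real pi * \<i> * z / of_real h))"
    using assms unfolding q_holomorphic_def by blast
  thus "q_holomorphic h (\<lambda>z. F z + G z)" "q_holomorphic h (\<lambda>z. F z * G z)"
    unfolding q_holomorphic_def
    by (intro exI[of _ "\<lambda>w. f w + g w"] exI[of _ "\<lambda>w. f w * g w"], auto intro!: holomorphic_intros)+
qed

text \<open>The old local parameter is the \<open>m\<close>-th power of the new one, so
  \<open>g w\<close> is replaced by \<open>g (w ^ m)\<close>.\<close>

lemma q_holomorphic_rescale:
  assumes F: "q_holomorphic h F" and "h > 0" "m > 0"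
  shows "q_holomorphic (h * real m) F"
proof -
  obtain g where g: "g holomorphic_on ball 0 1"
    "\<forall>z\<in>upper_half_plane. F z = g (exp (2 * of_real pi * \<i> * z / of_real h))"
    using F unfolding q_holomorphic_def by blast
  have "(\<lambda>w. g (w ^ m)) holomorphic_on ball 0 1"
    using g(1) \<open>m > 0\<close>
    by (intro holomorphic_on_compose_gen[of "\<lambda>w. w ^ m" _ g "ball 0 1", unfolded o_def] holomorphic_intros)
      (auto simp: norm_power power_less_one_iff)
  moreover have "exp (2 * of_real pi * \<i> * z / of_real (h * real m)) ^ m = exp (2 * of_real pi * \<i> * z / of_real h)" for z
    unfolding exp_of_nat_mult[symmetric] using assms by (simp add: field_simps)
  ultimately show ?thesis
    unfolding q_holomorphic_def using g(2) by (intro exI[of _ "\<lambda>w. g (w ^ m)"]) simp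
qed

lemma holomorphic_at_infinity_const [simp]: "holomorphic_at_infinity (\<lambda>_. c)"
  unfolding holomorphic_at_infinity_def by (intro exI[of _ "1::nat"] conjI exI[of _ "\<lambda>_. c"]) auto

lemma holomorphic_at_infinity_binop:
  assumes "holomorphic_at_infinity F" "holomorphic_at_infinity G"
  shows holomorphic_at_infinity_add: "holomorphic_at_infinity (\<lambda>z. F z + G z)"
    and holomorphic_at_infinity_mult: "holomorphic_at_infinity (\<lambda>z. F z * G z)"
proof -
  obtain h h' :: nat where h: "h > 0" "q_holomorphic h F" "h' > 0" "q_holomorphic h' G"
    using assms unfolding holomorphic_at_infinity_iff by blast
  have "q_holomorphic (h * h') F" "q_holomorphic (h * h') G"
    using q_holomorphic_rescale[of h F h'] q_holomorphic_rescale[of h' G h] h by (simp_all add: mult.commute)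
  from q_holomorphic_binop[OF this]
  show "holomorphic_at_infinity (\<lambda>z. F z + G z)" "holomorphic_at_infinity (\<lambda>z. F z * G z)"
    unfolding holomorphic_at_infinity_iff using h by (auto intro!: exI[of _ "h * h'"])
qed

lemma holomorphic_at_infinity_diff:
  assumes "holomorphic_at_infinity F" "holomorphic_at_infinity G"
  shows "holomorphic_at_infinity (\<lambda>z. F z - G z)"
  using holomorphic_at_infinity_add[OF assms(1) holomorphic_at_infinity_mult[OF holomorphic_at_infinity_const[of "-1"] assms(2)]]
  by simp

text \<open>In the local parameter \<open>w\<close> the operator \<open>D\<close> becomes
  \<open>w\<close> times differentiation by \<open>w\<close>, divided by \<open>h\<close>. This
  again gives a holomorphic function on the disc, so \<open>D\<close> preserves holomorphy at
  infinity.\<close>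

lemma has_field_derivative_q_expansion:
  assumes g: "g holomorphic_on ball 0 1"
    and F: "\<forall>z\<in>upper_half_plane. F z = g (exp (2 * of_real pi * \<i> * z / of_real h))"
    and h: "h > 0" and z: "Im z > 0"
  defines "w \<equiv> exp (2 * of_real pi * \<i> * z / of_real h)"
  shows "(F has_field_derivative (2 * of_real pi * \<i> / of_real h * (w * deriv g w))) (at z)"
proof (rule has_field_derivative_transform_within_open[OF _ open_upper_half_plane])
  have "w \<in> ball 0 1" using norm_exp_upper_half_plane[OF h z] by (simp add: w_def)
  hence "(g has_field_derivative deriv g w) (at w)"
    using g by (rule holomorphic_derivI[OF _ open_ball, rotated])
  moreover have "((\<lambda>z. exp (2 * of_real pi * \<i> * z / of_real h)) has_field_derivative
      w * (2 * of_real pi * \<i> / of_real h)) (at z)"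
    using h by (auto intro!: derivative_eq_intros simp: w_def)
  ultimately have "((\<lambda>z. g (exp (2 * of_real pi * \<i> * z / of_real h))) has_field_derivative
      deriv g w * (w * (2 * of_real pi * \<i> / of_real h))) (at z)"
    unfolding w_def by (rule DERIV_chain2)
  moreover have "deriv g w * (w * (2 * of_real pi * \<i> / of_real h)) =
      2 * of_real pi * \<i> / of_real h * (w * deriv g w)"
    by simp
  ultimately show "((\<lambda>z. g (exp (2 * of_real pi * \<i> * z / of_real h))) has_field_derivative
      (2 * of_real pi * \<i> / of_real h * (w * deriv g w))) (at z)"
    by metis
qed (use z F in auto)

lemma holomorphic_at_infinity_imp_holomorphic_on:
  assumes "holomorphic_at_infinity F"
  shows "F holomorphic_on upper_half_plane"
proof -
  obtain h :: nat and g where "h > 0" "g holomorphic_on ball 0 1"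
    "\<forall>z\<in>upper_half_plane. F z = g (exp (2 * of_real pi * \<i> * z / of_real (real h)))"
    using assms unfolding holomorphic_at_infinity_def by auto
  thus ?thesis
    using has_field_derivative_q_expansion[of g F "real h"]
    unfolding holomorphic_on_open[OF open_upper_half_plane] by (metis of_nat_0_less_iff upper_half_plane_iff)
qed

lemma holomorphic_at_infinity_D:
  assumes "holomorphic_at_infinity F"
  shows "holomorphic_at_infinity (D F)"
proof -
  obtain h :: nat and g where h: "h > 0" and g: "g holomorphic_on ball 0 1"
    and F: "\<forall>z\<in>upper_half_plane. F z = g (exp (2 * of_real pi * \<i> * z / of_real (real h)))"
    using assms unfolding holomorphic_at_infinity_def by auto
  have "D F z = (\<lambda>w. w * deriv g w / of_nat h) (exp (2 * of_real pi * \<i> * z / of_nat h))" if "Im z > 0" for z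
    using has_field_derivative_q_expansion[OF g F _ that] h
    by (simp add: D_def DERIV_imp_deriv)
  moreover have "(\<lambda>w. w * deriv g w / of_nat h) holomorphic_on ball 0 1"
    using g h by (auto intro!: holomorphic_intros)
  ultimately show ?thesis
    unfolding holomorphic_at_infinity_def using h by (intro exI[of _ h]) auto
qed

text \<open>For \<open>B\<close> not divisible by \<open>E\<close> the width of the cusp is multiplied by \<open>E\<close>, and the translation
  becomes a rotation of the unit disc.\<close>

lemma holomorphic_at_infinity_affine:
  assumes F: "holomorphic_at_infinity F" and A: "A > 0" and E: "E > 0"
  shows "holomorphic_at_infinity (\<lambda>z. F ((of_nat A * z + of_int B) / of_nat E))"
proof -
  obtain h :: nat and g where h: "h > 0" and g: "g holomorphic_on ball 0 1"
    and F: "\<forall>z\<in>upper_half_plane. F z = g (exp (2 * of_real pi * \<i> * z / of_nat h))"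
    using F unfolding holomorphic_at_infinity_def by blast
  define u where "u = exp (2 * of_real pi * \<i> * of_int B / of_nat (h * E))"
  have u: "norm u = 1" by (simp add: u_def Re_divide_of_nat)
  have "(\<lambda>w. g (u * w ^ A)) holomorphic_on ball 0 1"
    using g A
    by (intro holomorphic_on_compose_gen[of "\<lambda>w. u * w ^ A" _ g "ball 0 1", unfolded o_def] holomorphic_intros)
      (auto simp: norm_power norm_mult u power_less_one_iff)
  moreover have "F ((of_nat A * z + of_int B) / of_nat E) = g (u * exp (2 * of_real pi * \<i> * z / of_nat (h * E)) ^ A)"
    if "Im z > 0" for z
  proof -
    have "Im ((of_nat A * z + of_int B) / of_nat E) > 0"
      using that A E by (simp add: Im_divide_of_nat)
    moreover have "u * exp (2 * of_real pi * \<i> * z / of_nat (h * E)) ^ A =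
        exp (2 * of_real pi * \<i> * ((of_nat A * z + of_int B) / of_nat E) / of_nat h)"
      unfolding u_def exp_of_nat_mult[symmetric] exp_add[symmetric]
      using h E by (intro arg_cong[of _ _ exp]) (simp add: field_simps)
    ultimately show ?thesis using F by simp
  qed
  ultimately show ?thesis
    unfolding holomorphic_at_infinity_def using h E
    by (intro exI[of _ "h * E"]) (auto intro!: exI[of _ "\<lambda>w. g (u * w ^ A)"])
qed

lemma holomorphic_at_infinity_E2: "holomorphic_at_infinity E2"
proof -
  define g where "g = (\<lambda>w. \<Sum>n. of_nat (divisor_sigma (Suc n)) * (w :: complex) ^ n)"
  have "(\<lambda>n. of_nat (divisor_sigma (Suc n)) * w ^ n) sums g w" if "norm w < 1" for w :: complex
  \<comment> \<open>Convergence comes from dividing the series in \<open>w ^ Suc n\<close> by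
    \<open>w\<close>, which excludes the origin.\<close>
  proof (cases "w = 0")
    case True
    thus ?thesis by (simp add: g_def)
  next
    case False
    from summable_mult[OF summable_divisor_sigma[OF that], of "1 / w"] False
    show ?thesis by (simp add: g_def summable_sums field_simps)
  qed
  hence sums: "(\<lambda>n. of_nat (divisor_sigma (Suc n)) * w ^ n) sums g w" if "w \<in> ball 0 1" for w :: complex
    using that by simp
  have "g holomorphic_on ball 0 1"
    by (rule power_series_holomorphic[of 0 1 "\<lambda>n. of_nat (divisor_sigma (Suc n))"]) (use sums in simp)
  hence "(\<lambda>w. 1 - 24 * (w * g w)) holomorphic_on ball 0 1"
    by (intro holomorphic_intros)
  moreover have "E2 z = (\<lambda>w. 1 - 24 * (w * g w)) (exp (2 * of_real pi * \<i> * z / of_nat 1))" if "Im z > 0" for z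
  proof -
    have "norm (exp (2 * of_real pi * \<i> * z)) < 1" using that by simp
    hence "(\<lambda>n. exp (2 * of_real pi * \<i> * z) * (of_nat (divisor_sigma (Suc n)) * exp (2 * of_real pi * \<i> * z) ^ n)) sums
       (exp (2 * of_real pi * \<i> * z) * g (exp (2 * of_real pi * \<i> * z)))"
      by (intro sums_mult sums) simp
    thus ?thesis by (simp add: E2_def sums_iff mult_ac)
  qed
  ultimately show ?thesis
    unfolding holomorphic_at_infinity_def by (intro exI[of _ "1::nat"]) auto
qed

lemma E2_add_of_int: "E2 (z + of_int n) = E2 z"
proof -
  have "exp (2 * of_real pi * \<i> * (z + of_int n)) = exp (2 * of_real pi * \<i> * z) * exp (2 * of_int n * of_real pi * \<i>)"
    by (simp add: exp_add[symmetric] algebra_simps)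
  also have "exp (2 * of_int n * of_real pi * \<i>) = 1" by (simp add: exp_eq_1)
  finally show ?thesis by (simp add: E2_def)
qed

subsection \<open>The transformation law of \<open>E2\<close> and the scaling matrices\<close>

lemma moebius_denominator_nonzero:
  fixes a b c d :: int
  assumes "a * d - b * c = 1" and "Im z > 0"
  shows "of_int c * z + of_int d \<noteq> 0"
proof
  assume "of_int c * z + of_int d = 0"
  hence "real_of_int c * Im z = 0" "real_of_int c * Re z + real_of_int d = 0"
    by (auto simp: complex_eq_iff)
  hence "c = 0" "d = 0" using assms(2) by auto
  thus False using assms(1) by simp
qed

lemma moebius_upper_half_plane:
  fixes a b c d :: int
  assumes "a * d - b * c = 1" and "Im z > 0"
  shows "Im ((of_int a * z + of_int b) / (of_int c * z + of_int d)) > 0"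
proof -
  have "Im ((of_int a * z + of_int b) * cnj (of_int c * z + of_int d)) = of_int (a * d - b * c) * Im z"
    by (simp add: algebra_simps)
  thus ?thesis
    unfolding Im_complex_div_gt_0 using assms by simp
qed

lemma E2_moebius:
  fixes a b c d :: int
  assumes "a * d - b * c = 1" and z: "Im z > 0"
  shows "E2 ((of_int a * z + of_int b) / (of_int c * z + of_int d)) =
    (of_int c * z + of_int d) ^ 2 * E2 z + 6 / (of_real pi * \<i>) * of_int c * (of_int c * z + of_int d)"
  using assms(1)
proof (induction "nat \<bar>c\<bar>" arbitrary: a b c d rule: less_induct)
  case less
  show ?case
  \<comment> \<open>One step of the Euclidean algorithm on the first column: the matrix is \<open>T^q S\<close> times
    \<open>(- c, - d; r, t)\<close>, where \<open>T\<close> is \<open>z \<mapsto> z + 1\<close> and \<open>S\<close> is \<open>z \<mapsto> - 1 / z\<close>.\<close>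
  proof (cases "c = 0")
    case True
    hence ad: "a * d = 1" using less.prems by simp
    \<comment> \<open>The matrix is a translation up to sign, and the sign disappears in the even
      weight 2.\<close>
    hence "d = 1 \<or> d = - 1" "a = d" using zmult_eq_1_iff[of a d] by auto
    hence "(of_int a * z + of_int b) / of_int d = z + of_int (d * b)" "complex_of_int d ^ 2 = 1"
      by auto
    thus ?thesis using True by (simp add: E2_add_of_int del: of_int_mult)
  next
    case False
    define q where "q = a div c"
    define r where "r = a mod c"
    define t where "t = b - d * q"
    have r: "nat \<bar>r\<bar> < nat \<bar>c\<bar>" using abs_mod_less[OF False, of a] by (simp add: r_def)
    have a: "a = q * c + r" by (simp add: q_def r_def)
    have det: "(- c) * t - (- d) * r = 1"
      using less.prems by (simp add: a t_def algebra_simps)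
    define J where "J = of_int c * z + of_int d"
    define R where "R = of_int r * z + of_int t"
    have J: "J \<noteq> 0" unfolding J_def using less.prems z by (rule moebius_denominator_nonzero)
    have R: "R \<noteq> 0" unfolding R_def using det z by (rule moebius_denominator_nonzero)
    have \<tau>: "Im ((- J) / R) > 0"
      using moebius_upper_half_plane[OF det z] by (simp add: J_def R_def)
    have IH: "E2 (- J / R) = R ^ 2 * E2 z + 6 / (of_real pi * \<i>) * of_int r * R"
      using less.hyps[OF r det] by (simp add: J_def R_def)
    \<comment> \<open>The determinant condition is what merges the correction term of
      \<open>S\<close> with the one from the induction hypothesis.\<close>
    have "J * of_int r - of_int c * R = of_int (- c * t + d * r)"
      by (simp add: J_def R_def algebra_simps)
    also have "- c * t + d * r = 1" using det by simp
    finally have cR: "of_int c * R = J * of_int r - 1" by (simp add: algebra_simps)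
    have "(of_int a * z + of_int b) / J = - 1 / (- J / R) + of_int q"
      using J R by (simp add: field_simps) (simp add: J_def R_def a t_def algebra_simps)
    also have "E2 \<dots> = (- J / R) ^ 2 * E2 (- J / R) + 6 / (of_real pi * \<i>) * (- J / R)"
      by (simp only: E2_add_of_int E2_minus_inverse[OF \<tau>])
    also have "\<dots> = J ^ 2 * E2 z + 6 / (of_real pi * \<i>) * (J * (J * of_int r - 1) / R)"
      unfolding IH using R by (simp add: field_simps power2_eq_square)
    also have "\<dots> = J ^ 2 * E2 z + 6 / (of_real pi * \<i>) * of_int c * J"
      unfolding cR[symmetric] using R by simp
    finally show ?thesis by (simp only: J_def)
  qed
qed

lemma slash_2_E2:
  assumes "(a, b, c, d) \<in> SL2Z" and "Im z > 0"
  shows "slash 2 E2 (a, b, c, d) z = E2 z + 6 / (of_real pi * \<i>) * (of_int c / (of_int c * z + of_int d))"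
proof -
  have *: "a * d - b * c = 1" using assms by (simp add: SL2Z_def)
  show ?thesis
    using moebius_denominator_nonzero[OF * assms(2)]
    unfolding slash_def split_conv E2_moebius[OF * assms(2)]
    by (simp add: add_divide_distrib power2_eq_square)
qed

text \<open>\<open>(n, 0; 0, 1) \<gamma> = \<gamma>' (A, B; 0, E)\<close> as a product of matrices.\<close>

definition scaling_factorization ::
    "nat \<Rightarrow> int \<times> int \<times> int \<times> int \<Rightarrow> int \<times> int \<times> int \<times> int \<Rightarrow> nat \<Rightarrow> int \<Rightarrow> nat \<Rightarrow> bool" where
  "scaling_factorization n = (\<lambda>(p, q, r, s) (p', q', r', s') A B E.
     A > 0 \<and> E > 0 \<and> A * E = n \<and> int n * p = p' * int A \<and> int n * q = p' * B + q' * int E \<and>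
     r = r' * int A \<and> s = r' * B + s' * int E)"

text \<open>A Hermite normal form: dividing the first column \<open>(n p, r)\<close> by its gcd
  makes it primitive, and Bezout coefficients complete it to a matrix of determinant 1.\<close>

lemma scaling_factorization_exists:
  assumes "\<gamma> \<in> SL2Z" and n: "n > 0"
  obtains \<gamma>' A B E where "\<gamma>' \<in> SL2Z" and "scaling_factorization n \<gamma> \<gamma>' A B E"
proof -
  obtain p q r s where \<gamma>: "\<gamma> = (p, q, r, s)" and det: "p * s - q * r = 1"
    using assms by (cases \<gamma>) (auto simp: SL2Z_def)
  define g where "g = gcd (int n * p) r"
  have "p \<noteq> 0 \<or> r \<noteq> 0" using det by auto
  hence g: "g > 0" using n by (auto simp: g_def)
  define p' r' where "p' = int n * p div g" and "r' = r div g"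
  have p': "int n * p = p' * g" and r': "r = r' * g" by (simp_all add: p'_def r'_def g_def)
  obtain x y where "x * (int n * p) + y * r = g"
    using bezout_int unfolding g_def by blast
  moreover have "g * (x * p' + y * r') = x * (p' * g) + y * (r' * g)" by (simp add: algebra_simps)
  ultimately have "g * (x * p' + y * r') = g * 1" by (simp only: p'[symmetric] r'[symmetric] mult_1_right)
  hence xy: "x * p' + y * r' = 1" using g by simp
  \<comment> \<open>\<open>B\<close> and \<open>E\<close> are the entries of the second column
    \<open>(n q, s)\<close> after multiplication by the inverse \<open>(x, y; - r', p')\<close> of
    the new matrix.\<close>
  define B where "B = x * (int n * q) + y * s"
  define E where "E = p' * s - r' * (int n * q)"
  have "g * E = (p' * g) * s - (r' * g) * (int n * q)" by (simp add: E_def algebra_simps)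
  also have "\<dots> = int n * (p * s - q * r)" by (simp only: p'[symmetric] r'[symmetric]) (simp add: algebra_simps)
  finally have gE: "g * E = int n" using det by simp
  hence E: "E > 0" using g n by (metis of_nat_0_less_iff zero_less_mult_pos)
  have "(p', - y, r', x) \<in> SL2Z" using xy by (simp add: SL2Z_def algebra_simps)
  moreover have "scaling_factorization n \<gamma> (p', - y, r', x) (nat g) B (nat E)"
  proof -
    have "nat g * nat E = n" using gE g E by (simp flip: nat_mult_distrib)
    moreover have "int n * q = p' * B + - y * E"
    proof -
      have "p' * B + - y * E = (x * p' + y * r') * (int n * q)" by (simp add: B_def E_def algebra_simps)
      thus ?thesis using xy by simp
    qed
    moreover have "s = r' * B + x * E"
    proof -
      have "r' * B + x * E = (x * p' + y * r') * s" by (simp add: B_def E_def algebra_simps)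
      thus ?thesis using xy by simp
    qed
    ultimately show ?thesis
      using g E p' r' by (simp add: scaling_factorization_def \<gamma>)
  qed
  ultimately show thesis using that by blast
qed

text \<open>The matrix identity says that \<open>n\<close> times the image of \<open>z\<close> under
  the original matrix is the image of \<open>\<tau>\<close> under the new one. The two denominators
  differ by the factor \<open>E\<close>, whence \<open>E ^ k\<close>.\<close>

lemma slash_scaled:
  assumes "scaling_factorization n (p, q, r, s) (p', q', r', s') A B E"
    and "(p, q, r, s) \<in> SL2Z" and z: "Im z > 0"
  defines "\<tau> \<equiv> (of_nat A * z + of_int B) / of_nat E"
  shows "of_int r' * \<tau> + of_int s' = (of_int r * z + of_int s) / of_nat E"
    and "slash k (\<lambda>z. f (of_nat n * z)) (p, q, r, s) z = slash k f (p', q', r', s') \<tau> / of_nat E ^ k"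
proof -
  have f: "A > 0" "E > 0" "int n * p = p' * int A" "int n * q = p' * B + q' * int E"
     "r = r' * int A" "s = r' * B + s' * int E"
    using assms(1) by (auto simp: scaling_factorization_def)
  have E: "complex_of_nat E \<noteq> 0" using f by simp
  show den: "of_int r' * \<tau> + of_int s' = (of_int r * z + of_int s) / of_nat E"
    using E by (simp add: \<tau>_def f(5,6) field_simps)
  have "of_nat n * (of_int p * z + of_int q) = of_int (int n * p) * z + of_int (int n * q)"
    by (simp add: algebra_simps)
  also have "\<dots> = (of_int p' * \<tau> + of_int q') * of_nat E"
    unfolding f(3,4) using E by (simp add: \<tau>_def field_simps)
  finally have num: "of_int p' * \<tau> + of_int q' = of_nat n * (of_int p * z + of_int q) / of_nat E"
    using E by (simp add: field_simps)
  show "slash k (\<lambda>z. f (of_nat n * z)) (p, q, r, s) z = slash k f (p', q', r', s') \<tau> / of_nat E ^ k"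
    unfolding slash_def split_conv den num using E by (simp add: power_divide)
qed

text \<open>Since \<open>r = r' * A\<close> and \<open>n = A * E\<close>, the non-modular term
  depends on \<open>n\<close> and the lower row only, whatever the factorization. This is what
  allows it to cancel at every cusp.\<close>

lemma slash_2_E2_scaled:
  assumes fac: "scaling_factorization n (p, q, r, s) \<gamma>' A B E"
    and \<gamma>: "(p, q, r, s) \<in> SL2Z" "\<gamma>' \<in> SL2Z" and z: "Im z > 0"
  shows "slash 2 (\<lambda>z. E2 (of_nat n * z)) (p, q, r, s) z =
    E2 ((of_nat A * z + of_int B) / of_nat E) / of_nat E ^ 2 +
      6 / (of_real pi * \<i> * of_nat n) * (of_int r / (of_int r * z + of_int s))"
proof -
  obtain p' q' r' s' where \<gamma>': "\<gamma>' = (p', q', r', s')" by (cases \<gamma>')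
  have AE: "A > 0" "E > 0" "n = A * E" "r = r' * int A"
    using fac by (auto simp: scaling_factorization_def \<gamma>')
  hence "Im ((of_nat A * z + of_int B) / of_nat E) > 0"
    using z by (simp add: Im_divide_of_nat)
  from slash_2_E2[OF \<gamma>(2)[unfolded \<gamma>'] this] slash_scaled[OF fac[unfolded \<gamma>'] \<gamma>(1) z]
  have "slash 2 (\<lambda>z. E2 (of_nat n * z)) (p, q, r, s) z =
      (E2 ((of_nat A * z + of_int B) / of_nat E) +
        6 / (of_real pi * \<i>) * (of_int r' / ((of_int r * z + of_int s) / of_nat E))) / of_nat E ^ 2"
    by simp
  also have "\<dots> = E2 ((of_nat A * z + of_int B) / of_nat E) / of_nat E ^ 2 +
      6 / (of_real pi * \<i>  * of_nat (A * E)) * (of_int (r' * int A) / (of_int r * z + of_int s))"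
  proof -
    have "(e + 6 / (of_real pi * \<i>) * (of_int r' / (J / of_nat E))) / of_nat E ^ 2 =
        e / of_nat E ^ 2 + 6 / (of_real pi * \<i> * of_nat (A * E)) * (of_int (r' * int A) / J)" for e J :: complex
      using AE(1,2) by (simp add: add_divide_distrib power2_eq_square)
    thus ?thesis .
  qed
  finally show ?thesis by (simp only: AE(3,4)[symmetric])
qed

text \<open>The lower right entry \<open>s\<close> is kept, and so the value of the character is
  too.\<close>

lemma scaling_factorization_Gamma0:
  assumes "n > 0" and "int n dvd r"
  shows "scaling_factorization n (p, q, r, s) (p, int n * q, r div int n, s) n 0 1"
  using assms by (simp add: scaling_factorization_def)

lemma SL2Z_scaled:
  assumes "(p, q, r, s) \<in> SL2Z" and "n > 0" and "int n dvd r"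
  shows "(p, int n * q, r div int n, s) \<in> SL2Z"
  using assms by (auto simp: SL2Z_def mult_ac elim!: dvdE)

lemma Gamma0_scaled:
  assumes "(p, q, r, s) \<in> Gamma0 (M * n)" and "n > 0"
  shows "(p, int n * q, r div int n, s) \<in> Gamma0 M"
proof -
  obtain t where "r = int M * int n * t"
    using assms by (auto simp: Gamma0_def elim!: dvdE)
  thus ?thesis using assms by (simp add: Gamma0_def SL2Z_def mult_ac)
qed

lemma Gamma0_dvd: "m dvd n \<Longrightarrow> \<gamma> \<in> Gamma0 n \<Longrightarrow> \<gamma> \<in> Gamma0 m"
  by (auto simp: Gamma0_def intro: dvd_trans[of "int m" "int n"])

lemma Gamma0_coprime:
  assumes "(a, b, c, d) \<in> Gamma0 N"
  shows "coprime d (int N)"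
proof (rule coprimeI)
  fix e assume "e dvd d" "e dvd int N"
  moreover have "int N dvd c" and det: "a * d - b * c = 1" using assms by (auto simp: Gamma0_def SL2Z_def)
  ultimately have "e dvd a * d - b * c" by (intro dvd_diff dvd_mult) (auto intro: dvd_trans)
  thus "is_unit e" using det by simp
qed

text \<open>The Moebius map has derivative \<open>1 / J ^ 2\<close>, which raises the weight by 2;
  the second term comes from differentiating \<open>J ^ k\<close>. A separate \<open>K\<close> lets
  the same lemma serve for expansions at the cusps and for multiples of the function itself.\<close>

lemma deriv_slash:
  assumes \<gamma>: "(p, q, r, s) \<in> SL2Z" and g: "g holomorphic_on upper_half_plane" and z: "Im z > 0"
    and K: "\<And>z. Im z > 0 \<Longrightarrow> slash k g (p, q, r, s) z = K z"
  shows "slash (k + 2) (D g) (p, q, r, s) z =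
    D K z + of_nat k / (2 * of_real pi * \<i>) * (of_int r / (of_int r * z + of_int s)) * K z"
proof -
  define J where "J = of_int r * z + of_int s"
  define w where "w = (of_int p * z + of_int q) / J"
  have det: "p * s - q * r = 1" using \<gamma> by (simp add: SL2Z_def)
  have J: "J \<noteq> 0" unfolding J_def using det z by (rule moebius_denominator_nonzero)
  have w: "Im w > 0" unfolding w_def J_def using det z by (rule moebius_upper_half_plane)
  have "(g has_field_derivative deriv g w) (at w)"
    using g w by (intro holomorphic_derivI[OF _ open_upper_half_plane]) auto
  moreover have "((\<lambda>z. (of_int p * z + of_int q) / (of_int r * z + of_int s)) has_field_derivative 1 / J ^ 2) (at z)"
  proof -
    have "((\<lambda>z. (of_int p * z + of_int q) / (of_int r * z + of_int s)) has_field_derivative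
        (of_int p * J - (of_int p * z + of_int q) * of_int r) / (J * J)) (at z)"
      using J by (auto intro!: derivative_eq_intros simp: J_def)
    moreover have "of_int p * J - (of_int p * z + of_int q) * of_int r = of_int (p * s - q * r)"
      by (simp add: J_def algebra_simps)
    ultimately show ?thesis by (simp add: det power2_eq_square)
  qed
  ultimately have *: "((\<lambda>z. g ((of_int p * z + of_int q) / (of_int r * z + of_int s)))
      has_field_derivative deriv g w * (1 / J ^ 2)) (at z)"
    unfolding w_def J_def by (rule DERIV_chain2)
  have J': "((\<lambda>z. (of_int r * z + of_int s) ^ k) has_field_derivative of_nat k * J ^ (k - 1) * of_int r) (at z)"
    by (auto intro!: derivative_eq_intros simp: J_def)
  have "((\<lambda>z. slash k g (p, q, r, s) z) has_field_derivative
      (deriv g w * (1 / J ^ 2) * J ^ k - g w * (of_nat k * J ^ (k - 1) * of_int r)) / (J ^ k * J ^ k)) (at z)"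
    unfolding slash_def split_conv w_def J_def
    by (rule DERIV_divide[OF *[unfolded w_def J_def] J'[unfolded J_def]]) (use J in \<open>simp add: J_def\<close>)
  hence "(K has_field_derivative
      (deriv g w * (1 / J ^ 2) * J ^ k - g w * (of_nat k * J ^ (k - 1) * of_int r)) / (J ^ k * J ^ k)) (at z)"
    by (rule has_field_derivative_transform_within_open[OF _ open_upper_half_plane]) (use z K in auto)
  hence "deriv K z = (deriv g w * (1 / J ^ 2) * J ^ k - g w * (of_nat k * J ^ (k - 1) * of_int r)) / (J ^ k * J ^ k)"
    by (rule DERIV_imp_deriv)
  \<comment> \<open>The exponent \<open>k - 1\<close> is truncated at \<open>k = 0\<close>, where
    the factor \<open>of_nat k\<close> removes the term.\<close>
  also have "\<dots> = deriv g w / J ^ (k + 2) - of_nat k * (of_int r / J) * (g w / J ^ k)"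
    using J by (cases k) (simp_all add: field_simps power2_eq_square)
  also have "g w / J ^ k = K z"
    using K[OF z] by (simp add: slash_def w_def J_def)
  finally have "deriv g w / J ^ (k + 2) = deriv K z + of_nat k * (of_int r / J) * K z"
    by simp
  hence "1 / (2 * of_real pi * \<i>) * (deriv g w / J ^ (k + 2)) =
      1 / (2 * of_real pi * \<i>) * (deriv K z + of_nat k * (of_int r / J) * K z)"
    by (rule arg_cong)
  thus ?thesis
    by (simp add: slash_def D_def w_def J_def add_divide_distrib)
qed

subsection \<open>Modularity\<close>

text \<open>Holomorphy on the upper half-plane is not a separate goal: it is the cusp condition for
  the identity matrix.\<close>

lemma modular_formsI:
  assumes cusps: "\<And>p q r s. (p, q, r, s) \<in> SL2Z \<Longrightarrow>
      \<exists>K. holomorphic_at_infinity K \<and> (\<forall>z. Im z > 0 \<longrightarrow> slash k F (p, q, r, s) z = K z)"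
    and "\<And>p q r s z. (p, q, r, s) \<in> Gamma0 N \<Longrightarrow> Im z > 0 \<Longrightarrow> slash k F (p, q, r, s) z = chi s * F z"
  shows "F \<in> modular_forms k N chi"
proof -
  have *: "holomorphic_at_infinity (slash k F \<gamma>)" if "\<gamma> \<in> SL2Z" for \<gamma>
    using cusps[of "fst \<gamma>" "fst (snd \<gamma>)" "fst (snd (snd \<gamma>))" "snd (snd (snd \<gamma>))"] that holomorphic_at_infinity_cong
    by (metis prod.collapse)
  have "slash k F (1, 0, 0, 1) = F" by (simp add: slash_def)
  hence "F holomorphic_on upper_half_plane"
    using *[of "(1, 0, 0, 1)"] holomorphic_at_infinity_imp_holomorphic_on by (simp add: SL2Z_def)
  thus ?thesis using * assms(2) by (auto simp: modular_forms_def)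
qed

lemma D_scaled:
  assumes "f holomorphic_on upper_half_plane" and "n > 0" and "Im z > 0"
  shows "D (\<lambda>z. f (of_nat n * z)) z = of_nat n * D f (of_nat n * z)"
proof -
  have "(f has_field_derivative deriv f (of_nat n * z)) (at (of_nat n * z))"
    using assms by (intro holomorphic_derivI[OF _ open_upper_half_plane]) auto
  moreover have "((\<lambda>z. of_nat n * z) has_field_derivative of_nat n) (at z)"
    by (auto intro!: derivative_eq_intros)
  ultimately have "((\<lambda>z. f (of_nat n * z)) has_field_derivative deriv f (of_nat n * z) * of_nat n) (at z)"
    by (rule DERIV_chain2)
  thus ?thesis by (simp add: D_def DERIV_imp_deriv)
qed

lemma holomorphic_on_scaled:
  assumes "f holomorphic_on upper_half_plane" and "n > 0"
  shows "(\<lambda>z. f (of_nat n * z)) holomorphic_on upper_half_plane"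
  using assms
  by (intro holomorphic_on_compose_gen[of "\<lambda>z. of_nat n * z" _ f upper_half_plane, unfolded o_def] holomorphic_intros)
    auto

lemma E2_holomorphic: "E2 holomorphic_on upper_half_plane"
  by (rule holomorphic_at_infinity_imp_holomorphic_on[OF holomorphic_at_infinity_E2])

lemma scaled_slash_holomorphic_at_infinity:
  assumes "f \<in> modular_forms k M chi" and "scaling_factorization n \<gamma> \<gamma>' A B E" and "\<gamma>' \<in> SL2Z"
  shows "holomorphic_at_infinity (\<lambda>z. slash k f \<gamma>' ((of_nat A * z + of_int B) / of_nat E) / of_nat E ^ k)"
proof -
  have "A > 0" "E > 0"
    using assms(2) by (auto simp: scaling_factorization_def split: prod.splits)
  moreover have "holomorphic_at_infinity (slash k f \<gamma>')"
    using assms(1,3) by (simp add: modular_forms_def)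
  ultimately show ?thesis
    using holomorphic_at_infinity_mult[OF holomorphic_at_infinity_affine
        holomorphic_at_infinity_const[of "1 / of_nat E ^ k"]] by simp
qed

lemma E2_scaled_holomorphic_at_infinity:
  assumes "A > 0" and "E > 0"
  shows "holomorphic_at_infinity (\<lambda>z. E2 ((of_nat A * z + of_int B) / of_nat E) / of_nat E ^ 2)"
  using holomorphic_at_infinity_mult[OF holomorphic_at_infinity_affine[OF holomorphic_at_infinity_E2 assms, of B]
      holomorphic_at_infinity_const[of "1 / of_nat E ^ 2"]] by simp

text \<open>The derivative contributes \<open>k / (2 pi i) X K\<close>, and
  \<open>k / 12 * a\<close> times the term \<open>6 / (pi i a) X\<close> of \<open>E2\<close> is the
  same quantity. \<open>K\<close> has to be known near \<open>z\<close> because it is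
  differentiated; for \<open>H\<close> the point \<open>z\<close> suffices.\<close>

lemma slash_vartheta:
  assumes \<gamma>: "(p, q, r, s) \<in> SL2Z" and f: "f holomorphic_on upper_half_plane"
    and a: "a > 0" and b: "b > 0" and z: "Im z > 0"
    and K: "\<And>z. Im z > 0 \<Longrightarrow> slash k (\<lambda>z. f (of_nat b * z)) (p, q, r, s) z = K z"
    and H: "slash 2 (\<lambda>z. E2 (of_nat a * z)) (p, q, r, s) z =
      H z + 6 / (of_real pi * \<i> * of_nat a) * (of_int r / (of_int r * z + of_int s))"
  shows "slash (k + 2) (vartheta k a b f) (p, q, r, s) z = D K z - of_nat k / 12 * of_nat a * H z * K z"
proof -
  define J where "J = of_int r * z + of_int s"
  define w where "w = (of_int p * z + of_int q) / J"
  define X where "X = of_int r / J"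
  have det: "p * s - q * r = 1" using \<gamma> by (simp add: SL2Z_def)
  have J: "J \<noteq> 0" unfolding J_def using det z by (rule moebius_denominator_nonzero)
  have w: "Im w > 0" unfolding w_def J_def using det z by (rule moebius_upper_half_plane)
  have "slash (k + 2) (vartheta k a b f) (p, q, r, s) z =
      (of_nat b * D f (of_nat b * w) - of_nat k / 12 * of_nat a * E2 (of_nat a * w) * f (of_nat b * w)) / J ^ (k + 2)"
    by (simp add: slash_def vartheta_def w_def J_def)
  also have "of_nat b * D f (of_nat b * w) = D (\<lambda>z. f (of_nat b * z)) w"
    using D_scaled[OF f b w] by simp
  also have "(D (\<lambda>z. f (of_nat b * z)) w - of_nat k / 12 * of_nat a * E2 (of_nat a * w) * f (of_nat b * w)) / J ^ (k + 2) =
      D (\<lambda>z. f (of_nat b * z)) w / J ^ (k + 2) -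
      of_nat k / 12 * of_nat a * (E2 (of_nat a * w) / J ^ 2) * (f (of_nat b * w) / J ^ k)"
    using J by (simp add: diff_divide_distrib power_add power2_eq_square mult_ac)
  also have "D (\<lambda>z. f (of_nat b * z)) w / J ^ (k + 2) = D K z + of_nat k / (2 * of_real pi * \<i>) * X * K z"
    using deriv_slash[OF \<gamma> holomorphic_on_scaled[OF f b] z K] by (simp add: slash_def w_def J_def X_def)
  also have "E2 (of_nat a * w) / J ^ 2 = H z + 6 / (of_real pi * \<i> * of_nat a) * X"
    using H by (simp add: slash_def w_def J_def X_def)
  also have "f (of_nat b * w) / J ^ k = K z"
    using K[OF z] by (simp add: slash_def w_def J_def)
  also have "D K z + of_nat k / (2 * of_real pi * \<i>) * X * K z -
      of_nat k / 12 * of_nat a * (H z + 6 / (of_real pi * \<i> * of_nat a) * X) * K z =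
      D K z - of_nat k / 12 * of_nat a * H z * K z"
    using a by (simp add: algebra_simps)
  finally show ?thesis .
qed

text \<open>\<open>slash_vartheta\<close> is used twice: with general factorizations for the cusps,
  and with the diagonal ones for the invariance under \<open>Gamma0 N\<close>.\<close>

lemma vartheta_modular:
  assumes a: "a > 0" and b: "b > 0" and f: "f \<in> modular_forms k M chi"
  defines "N \<equiv> lcm (M * b) a"
  shows "vartheta k a b f \<in> modular_forms (k + 2) N (induced_character N chi)"
proof (rule modular_formsI)
  have hol: "f holomorphic_on upper_half_plane" using f by (simp add: modular_forms_def)
  {
    fix p q r s assume \<gamma>: "(p, q, r, s) \<in> SL2Z"
    obtain \<gamma>\<^sub>a A B E where a': "\<gamma>\<^sub>a \<in> SL2Z" "scaling_factorization a (p, q, r, s) \<gamma>\<^sub>a A B E"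
      using scaling_factorization_exists[OF \<gamma> a] by blast
    obtain \<gamma>\<^sub>b A' B' E' where b': "\<gamma>\<^sub>b \<in> SL2Z" "scaling_factorization b (p, q, r, s) \<gamma>\<^sub>b A' B' E'"
      using scaling_factorization_exists[OF \<gamma> b] by blast
    define K where "K = (\<lambda>z. slash k f \<gamma>\<^sub>b ((of_nat A' * z + of_int B') / of_nat E') / of_nat E' ^ k)"
    define H where "H = (\<lambda>z. E2 ((of_nat A * z + of_int B) / of_nat E) / of_nat E ^ 2)"
    have AE: "A > 0" "E > 0" using a'(2) by (auto simp: scaling_factorization_def split: prod.splits)
    have K: "holomorphic_at_infinity K"
      unfolding K_def using f b'(2,1) by (rule scaled_slash_holomorphic_at_infinity)
    have H: "holomorphic_at_infinity H"
      unfolding H_def using AE by (rule E2_scaled_holomorphic_at_infinity)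
    obtain p' q' r' s' where \<gamma>b: "\<gamma>\<^sub>b = (p', q', r', s')" by (cases \<gamma>\<^sub>b)
    have "slash (k + 2) (vartheta k a b f) (p, q, r, s) z = D K z - of_nat k / 12 * of_nat a * H z * K z"
      if z: "Im z > 0" for z
    proof (rule slash_vartheta[OF \<gamma> hol a b z])
      show "slash k (\<lambda>z. f (of_nat b * z)) (p, q, r, s) z = K z" if "Im z > 0" for z
        using slash_scaled(2)[OF b'(2)[unfolded \<gamma>b] \<gamma> that] by (simp add: K_def \<gamma>b)
      show "slash 2 (\<lambda>z. E2 (of_nat a * z)) (p, q, r, s) z =
          H z + 6 / (of_real pi * \<i> * of_nat a) * (of_int r / (of_int r * z + of_int s))"
        using slash_2_E2_scaled[OF a'(2) \<gamma> a'(1) z] by (simp add: H_def)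
    qed
    moreover have "holomorphic_at_infinity (\<lambda>z. D K z - of_nat k / 12 * of_nat a * H z * K z)"
      by (intro holomorphic_at_infinity_diff holomorphic_at_infinity_mult holomorphic_at_infinity_D
          holomorphic_at_infinity_const K H)
    ultimately show "\<exists>K. holomorphic_at_infinity K \<and>
        (\<forall>z. Im z > 0 \<longrightarrow> slash (k + 2) (vartheta k a b f) (p, q, r, s) z = K z)"
      by blast
  }
  fix p q r s z assume \<gamma>: "(p, q, r, s) \<in> Gamma0 N" and z: "Im z > 0"
  have \<gamma>1: "(p, q, r, s) \<in> SL2Z" and dvd: "int a dvd r" "int b dvd r"
    and \<gamma>Mb: "(p, q, r, s) \<in> Gamma0 (M * b)"
    using \<gamma> Gamma0_dvd[of a N] Gamma0_dvd[of b N] Gamma0_dvd[of "M * b" N]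
    by (auto simp: Gamma0_def N_def intro: dvd_trans[OF dvd_triv_right dvd_lcm1])
  \<comment> \<open>Divisibility of \<open>r\<close> by \<open>M * b\<close> gives
    \<open>K z = chi s * f (b z)\<close>, and divisibility by \<open>a\<close> gives
    \<open>H z = E2 (a z)\<close>.\<close>
  have "slash (k + 2) (vartheta k a b f) (p, q, r, s) z =
      D (\<lambda>z. chi s * f (of_nat b * z)) z - of_nat k / 12 * of_nat a * E2 (of_nat a * z) * (chi s * f (of_nat b * z))"
  proof (rule slash_vartheta[OF \<gamma>1 hol a b z])
    fix z assume z: "Im z > 0"
    have "slash k (\<lambda>z. f (of_nat b * z)) (p, q, r, s) z = slash k f (p, int b * q, r div int b, s) (of_nat b * z)"
      using slash_scaled(2)[OF scaling_factorization_Gamma0[OF b dvd(2)] \<gamma>1 z] by simp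
    also have "\<dots> = chi s * f (of_nat b * z)"
      using f Gamma0_scaled[OF \<gamma>Mb b] z b by (force simp: modular_forms_def)
    finally show "slash k (\<lambda>z. f (of_nat b * z)) (p, q, r, s) z = chi s * f (of_nat b * z)" .
  next
    from slash_2_E2_scaled[OF scaling_factorization_Gamma0[OF a dvd(1)] \<gamma>1 SL2Z_scaled[OF \<gamma>1 a dvd(1)] z]
    show "slash 2 (\<lambda>z. E2 (of_nat a * z)) (p, q, r, s) z =
        E2 (of_nat a * z) + 6 / (of_real pi * \<i> * of_nat a) * (of_int r / (of_int r * z + of_int s))"
      by simp
  qed
  also have "D (\<lambda>z. chi s * f (of_nat b * z)) z = chi s * D (\<lambda>z. f (of_nat b * z)) z"
    using holomorphic_on_scaled[OF hol b] z
    by (simp add: D_def deriv_cmult holomorphic_on_imp_differentiable_at[OF _ open_upper_half_plane])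
  also have "D (\<lambda>z. f (of_nat b * z)) z = of_nat b * D f (of_nat b * z)"
    by (rule D_scaled[OF hol b z])
  also have "chi s * (of_nat b * D f (of_nat b * z)) -
      of_nat k / 12 * of_nat a * E2 (of_nat a * z) * (chi s * f (of_nat b * z)) = chi s * vartheta k a b f z"
    by (simp add: vartheta_def algebra_simps)
  finally show "slash (k + 2) (vartheta k a b f) (p, q, r, s) z = induced_character N chi s * vartheta k a b f z"
    using Gamma0_coprime[OF \<gamma>] by (simp add: induced_character_def)
qed

section \<open>The weight 4 form built from two scalings of \<open>E2\<close>\<close>

text \<open>For \<open>a = b = 1\<close> this is \<open>12 * D E2 - E2 ^ 2\<close>, which equals
  minus the Eisenstein series of weight 4 by Ramanujan's identity.\<close>

definition E2_bracket :: "nat \<Rightarrow> nat \<Rightarrow> complex \<Rightarrow> complex" where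
  "E2_bracket a b z = 6 * of_nat a / of_nat b * D E2 (of_nat a * z)
     + 6 * of_nat b / of_nat a * D E2 (of_nat b * z) - E2 (of_nat a * z) * E2 (of_nat b * z)"

text \<open>Besides the terms of \<open>deriv_slash\<close> for \<open>H\<close>, the summand
  \<open>6 / (pi i a) X\<close> has derivative proportional to \<open>- X ^ 2\<close>. This
  contributes \<open>3 / (pi^2 a) X ^ 2\<close>, against \<open>- 6 / (pi^2 a) X ^ 2\<close> from
  the weight term.\<close>

lemma slash_D_E2_scaled:
  assumes \<gamma>: "(p, q, r, s) \<in> SL2Z" and a: "a > 0" and z: "Im z > 0"
    and H: "\<And>z. Im z > 0 \<Longrightarrow> slash 2 (\<lambda>z. E2 (of_nat a * z)) (p, q, r, s) z =
      H z + 6 / (of_real pi * \<i> * of_nat a) * (of_int r / (of_int r * z + of_int s))"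
    and hol: "H holomorphic_on upper_half_plane"
  defines "X \<equiv> of_int r / (of_int r * z + of_int s)"
  shows "slash 4 (\<lambda>z. of_nat a * D E2 (of_nat a * z)) (p, q, r, s) z =
    D H z + 1 / (of_real pi * \<i>) * X * H z - 3 / (of_real pi ^ 2 * of_nat a) * X ^ 2"
proof -
  define K where "K = (\<lambda>z. H z + 6 / (of_real pi * \<i> * of_nat a) * (of_int r / (of_int r * z + of_int s)))"
  define w where "w = (of_int p * z + of_int q) / (of_int r * z + of_int s)"
  have det: "p * s - q * r = 1" using \<gamma> by (simp add: SL2Z_def)
  have J: "of_int r * z + of_int s \<noteq> 0" using det z by (rule moebius_denominator_nonzero)
  have w: "Im w > 0" unfolding w_def using det z by (rule moebius_upper_half_plane)
  have "((\<lambda>z. of_int r / (of_int r * z + of_int s)) has_field_derivative (- (X ^ 2))) (at z)"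
    using J by (auto intro!: derivative_eq_intros simp: X_def power2_eq_square)
  moreover have "(H has_field_derivative deriv H z) (at z)"
    using hol z by (intro holomorphic_derivI[OF _ open_upper_half_plane]) auto
  ultimately have "(K has_field_derivative
      (deriv H z + 6 / (of_real pi * \<i> * of_nat a) * (- (X ^ 2)))) (at z)"
    unfolding K_def by (intro DERIV_add DERIV_cmult)
  hence "deriv K z = deriv H z + 6 / (of_real pi * \<i> * of_nat a) * (- (X ^ 2))"
    by (rule DERIV_imp_deriv)
  hence DK: "D K z = D H z + 1 / (2 * of_real pi * \<i>) * (6 / (of_real pi * \<i> * of_nat a) * (- (X ^ 2)))"
    by (simp only: D_def distrib_left)
  have "slash 4 (\<lambda>z. of_nat a * D E2 (of_nat a * z)) (p, q, r, s) z =
      slash (2 + 2) (D (\<lambda>z. E2 (of_nat a * z))) (p, q, r, s) z"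
    using D_scaled[OF E2_holomorphic a w] by (simp add: slash_def w_def)
  also have "\<dots> = D K z + of_nat 2 / (2 * of_real pi * \<i>) * X * K z"
    unfolding X_def
    by (rule deriv_slash[OF \<gamma> holomorphic_on_scaled[OF E2_holomorphic a] z]) (simp add: H K_def)
  also have "\<dots> = D H z + 1 / (of_real pi * \<i>) * X * H z - 3 / (of_real pi ^ 2 * of_nat a) * X ^ 2"
  proof -
    have "K z = H z + 6 / (of_real pi * \<i> * of_nat a) * X" by (simp add: K_def X_def)
    thus ?thesis unfolding DK using a by (simp add: field_simps power2_eq_square)
  qed
  finally show ?thesis .
qed

text \<open>The terms linear in \<open>X\<close> cancel against the mixed terms of the product. The
  two derivatives together give \<open>- 36 / (pi^2 a b) X ^ 2\<close>, and subtracting the product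
  restores exactly this amount.\<close>

lemma slash_E2_bracket:
  assumes \<gamma>: "(p, q, r, s) \<in> SL2Z" and a: "a > 0" and b: "b > 0" and z: "Im z > 0"
    and H: "\<And>z. Im z > 0 \<Longrightarrow> slash 2 (\<lambda>z. E2 (of_nat a * z)) (p, q, r, s) z =
      H z + 6 / (of_real pi * \<i> * of_nat a) * (of_int r / (of_int r * z + of_int s))"
    and H': "\<And>z. Im z > 0 \<Longrightarrow> slash 2 (\<lambda>z. E2 (of_nat b * z)) (p, q, r, s) z =
      H' z + 6 / (of_real pi * \<i> * of_nat b) * (of_int r / (of_int r * z + of_int s))"
    and hol: "H holomorphic_on upper_half_plane" "H' holomorphic_on upper_half_plane"
  shows "slash 4 (E2_bracket a b) (p, q, r, s) z =
    6 / of_nat b * D H z + 6 / of_nat a * D H' z - H z * H' z"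
proof -
  define J where "J = of_int r * z + of_int s"
  define w where "w = (of_int p * z + of_int q) / J"
  define X where "X = of_int r / J"
  define \<pi> where "\<pi> = complex_of_real pi"
  have "slash 4 (E2_bracket a b) (p, q, r, s) z =
      6 / of_nat b * (of_nat a * D E2 (of_nat a * w) / J ^ 4) +
      6 / of_nat a * (of_nat b * D E2 (of_nat b * w) / J ^ 4) -
      E2 (of_nat a * w) / J ^ 2 * (E2 (of_nat b * w) / J ^ 2)"
    unfolding slash_def E2_bracket_def split_conv J_def[symmetric] w_def[symmetric]
    by (simp add: add_divide_distrib diff_divide_distrib mult.assoc flip: power_add)
  also have "of_nat a * D E2 (of_nat a * w) / J ^ 4 = D H z + 1 / (\<pi> * \<i>) * X * H z - 3 / (\<pi> ^ 2 * of_nat a) * X ^ 2"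
    using slash_D_E2_scaled[OF \<gamma> a z H hol(1)] by (simp add: slash_def w_def J_def X_def \<pi>_def)
  also have "of_nat b * D E2 (of_nat b * w) / J ^ 4 = D H' z + 1 / (\<pi> * \<i>) * X * H' z - 3 / (\<pi> ^ 2 * of_nat b) * X ^ 2"
    using slash_D_E2_scaled[OF \<gamma> b z H' hol(2)] by (simp add: slash_def w_def J_def X_def \<pi>_def)
  also have "E2 (of_nat a * w) / J ^ 2 = H z + 6 / (\<pi> * \<i> * of_nat a) * X"
    using H[OF z] by (simp add: slash_def w_def J_def X_def \<pi>_def)
  also have "E2 (of_nat b * w) / J ^ 2 = H' z + 6 / (\<pi> * \<i> * of_nat b) * X"
    using H'[OF z] by (simp add: slash_def w_def J_def X_def \<pi>_def)
  also have "6 / of_nat b * (D H z + 1 / (\<pi> * \<i>) * X * H z - 3 / (\<pi> ^ 2 * of_nat a) * X ^ 2) +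
      6 / of_nat a * (D H' z + 1 / (\<pi> * \<i>) * X * H' z - 3 / (\<pi> ^ 2 * of_nat b) * X ^ 2) -
      (H z + 6 / (\<pi> * \<i> * of_nat a) * X) * (H' z + 6 / (\<pi> * \<i> * of_nat b) * X) =
      6 / of_nat b * D H z + 6 / of_nat a * D H' z - H z * H' z"
    using a b by (simp add: algebra_simps power2_eq_square \<pi>_def)
  finally show ?thesis .
qed

text \<open>As for \<open>vartheta\<close>, one formula serves both the cusps and the invariance; at
  level \<open>a * b\<close> both scalings can be moved past the matrix diagonally, leaving
  \<open>H z = E2 (a z)\<close> and \<open>H' z = E2 (b z)\<close>.\<close>

lemma E2_bracket_modular:
  assumes a: "a > 0" and b: "b > 0"
  shows "E2_bracket a b \<in> modular_forms 4 (a * b) (trivial_character (a * b))"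
proof (rule modular_formsI)
  fix p q r s assume \<gamma>: "(p, q, r, s) \<in> SL2Z"
  have "\<exists>H. holomorphic_at_infinity H \<and> (\<forall>z. Im z > 0 \<longrightarrow> slash 2 (\<lambda>z. E2 (of_nat n * z)) (p, q, r, s) z =
      H z + 6 / (of_real pi * \<i> * of_nat n) * (of_int r / (of_int r * z + of_int s)))" if n: "n > 0" for n
  proof -
    obtain \<gamma>' A B E where \<gamma>': "\<gamma>' \<in> SL2Z" "scaling_factorization n (p, q, r, s) \<gamma>' A B E"
      using scaling_factorization_exists[OF \<gamma> n] by blast
    hence "A > 0" "E > 0" by (auto simp: scaling_factorization_def split: prod.splits)
    thus ?thesis
      using E2_scaled_holomorphic_at_infinity slash_2_E2_scaled[OF \<gamma>'(2) \<gamma> \<gamma>'(1)] by blast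
  qed
  from this[OF a] this[OF b] obtain H H' where H: "holomorphic_at_infinity H" "holomorphic_at_infinity H'"
    "\<And>z. Im z > 0 \<Longrightarrow> slash 2 (\<lambda>z. E2 (of_nat a * z)) (p, q, r, s) z =
      H z + 6 / (of_real pi * \<i> * of_nat a) * (of_int r / (of_int r * z + of_int s))"
    "\<And>z. Im z > 0 \<Longrightarrow> slash 2 (\<lambda>z. E2 (of_nat b * z)) (p, q, r, s) z =
      H' z + 6 / (of_real pi * \<i> * of_nat b) * (of_int r / (of_int r * z + of_int s))"
    by blast
  have "holomorphic_at_infinity (\<lambda>z. 6 / of_nat b * D H z + 6 / of_nat a * D H' z - H z * H' z)"
    by (intro holomorphic_at_infinity_diff holomorphic_at_infinity_add holomorphic_at_infinity_mult
        holomorphic_at_infinity_D holomorphic_at_infinity_const H)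
  thus "\<exists>K. holomorphic_at_infinity K \<and> (\<forall>z. Im z > 0 \<longrightarrow> slash 4 (E2_bracket a b) (p, q, r, s) z = K z)"
    using slash_E2_bracket[OF \<gamma> a b _ H(3,4)] H(1,2) holomorphic_at_infinity_imp_holomorphic_on by blast
next
  fix p q r s z assume \<gamma>: "(p, q, r, s) \<in> Gamma0 (a * b)" and z: "Im z > 0"
  have \<gamma>1: "(p, q, r, s) \<in> SL2Z" and dvd: "int a dvd r" "int b dvd r"
    using \<gamma> by (auto simp: Gamma0_def intro: dvd_mult_left dvd_mult_right)
  have E2: "slash 2 (\<lambda>z. E2 (of_nat n * z)) (p, q, r, s) z =
        E2 (of_nat n * z) + 6 / (of_real pi * \<i> * of_nat n) * (of_int r / (of_int r * z + of_int s))"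
    if "n > 0" "int n dvd r" "Im z > 0" for n z
  proof -
    from slash_2_E2_scaled[OF scaling_factorization_Gamma0 \<gamma>1 SL2Z_scaled[OF \<gamma>1]] that
    show ?thesis by simp
  qed
  have "slash 4 (E2_bracket a b) (p, q, r, s) z =
      6 / of_nat b * D (\<lambda>z. E2 (of_nat a * z)) z + 6 / of_nat a * D (\<lambda>z. E2 (of_nat b * z)) z -
      E2 (of_nat a * z) * E2 (of_nat b * z)"
    by (rule slash_E2_bracket[OF \<gamma>1 a b z E2[OF a dvd(1)] E2[OF b dvd(2)]])
      (use a b in \<open>auto intro: holomorphic_on_scaled E2_holomorphic\<close>)
  also have "\<dots> = E2_bracket a b z"
    using D_scaled[OF E2_holomorphic a z] D_scaled[OF E2_holomorphic b z] by (simp add: E2_bracket_def mult.assoc)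
  finally show "slash 4 (E2_bracket a b) (p, q, r, s) z = trivial_character (a * b) s * E2_bracket a b z"
    using Gamma0_coprime[OF \<gamma>] by (simp add: trivial_character_def)
qed

theorem theorem2p1:
  fixes a b k M :: nat and chi :: "int \<Rightarrow> complex" and f :: "complex \<Rightarrow> complex"
  assumes "a > 0" and "b > 0" and "k > 0" and "M > 0"
    and "dirichlet_character M chi" and "chi (-1) = (-1) ^ k"
    and "f \<in> modular_forms k M chi"
  shows "vartheta k a b f \<in>
           modular_forms (k + 2) (lcm (M * b) a) (induced_character (lcm (M * b) a) chi) \<and>
         (coprime a b \<longrightarrow>
           (\<lambda>z. 6 * of_nat a / of_nat b * D E2 (of_nat a * z)
              + 6 * of_nat b / of_nat a * D E2 (of_nat b * z)
              - E2 (of_nat a * z) * E2 (of_nat b * z))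
             \<in> modular_forms 4 (a * b) (trivial_character (a * b)))"
  using vartheta_modular[OF assms(1,2,7)] E2_bracket_modular[OF assms(1,2)]
  by (simp add: E2_bracket_def[abs_def])

end
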